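(* Let $p$ be a prime, let $G$ be an abelian $p$-group and let $L$ be a large subgroup of $G$. Then $G$ is a $\Sigma$-group if and only if $L$ is a $\Sigma$-group.
   Context: All groups are abelian and written additively. A subgroup $L$ of an abelian $p$-group $G$ is large if $L$ is fully invariant in $G$ (i.e. $f(L)\subseteq L$ for every endomorphism $f$ of $G$) and $G=L+B$ for every basic subgroup $B$ of $G$. Put $G^1=p^\omega G=\bigcap_{n<\omega}p^nG$. A subgroup $H$ of $G$ is high if it is maximal among the subgroups of $G$ with $H\cap G^1=0$. An abelian $p$-group $G$ is a $\Sigma$-group if some high subgroup of $G$ is a direct sum of cyclic groups. *)

theory Defs
  imports "HOL-Algebra.Algebra"
begin

text \<open>
  Abelian groups are written multiplicatively, as in \<open>HOL-Algebra\<close>: the multiple \<open>n x\<close>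
  is \<open>x [^] n\<close>, the sum \<open>L + B\<close> is \<open>L <#> B\<close>, and \<open>0\<close> is \<open>\<one>\<close>. A subgroup \<open>H\<close> of \<open>G\<close>, regarded as
  a group in its own right, is \<open>G\<lparr>carrier := H\<rparr>\<close>.
\<close>

definition abelian_p_group :: "nat \<Rightarrow> ('a, 'b) monoid_scheme \<Rightarrow> bool" where
  "abelian_p_group p G \<longleftrightarrow>
     comm_group G \<and> (\<forall>x\<in>carrier G. \<exists>n::nat. x [^]\<^bsub>G\<^esub> (p ^ n) = \<one>\<^bsub>G\<^esub>)"

definition multiples :: "nat \<Rightarrow> ('a, 'b) monoid_scheme \<Rightarrow> 'a set" where
  "multiples n G = (\<lambda>x. x [^]\<^bsub>G\<^esub> n) ` carrier G"

definition p_omega :: "nat \<Rightarrow> ('a, 'b) monoid_scheme \<Rightarrow> 'a set" where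
  "p_omega p G = (\<Inter>n::nat. multiples (p ^ n) G)"

definition divisible_group :: "('a, 'b) monoid_scheme \<Rightarrow> bool" where
  "divisible_group G \<longleftrightarrow> (\<forall>n::nat. n > 0 \<longrightarrow> multiples n G = carrier G)"

definition pure_subgroup :: "'a set \<Rightarrow> ('a, 'b) monoid_scheme \<Rightarrow> bool" where
  "pure_subgroup H G \<longleftrightarrow>
     subgroup H G \<and> (\<forall>n::nat. H \<inter> multiples n G = multiples n (G\<lparr>carrier := H\<rparr>))"

text \<open>
  \<open>G\<close> is the internal direct sum of a family of cyclic subgroups: the summation map from the
  external direct sum to \<open>G\<close> is an isomorphism. Taking a set of subgroups rather than an
  indexed family loses nothing, since only trivial summands could be repeated.
\<close>

definition direct_sum_of_cyclics :: "('a, 'b) monoid_scheme \<Rightarrow> bool" where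
  "direct_sum_of_cyclics G \<longleftrightarrow>
     (\<exists>\<C>. (\<forall>C\<in>\<C>. subgroup C G \<and> cyclic_group (subgroup_generated G C)) \<and>
          (\<lambda>x. gfinprod G x \<C>) \<in> iso (sum_group \<C> (\<lambda>C. subgroup_generated G C)) G)"

definition basic_subgroup :: "'a set \<Rightarrow> ('a, 'b) monoid_scheme \<Rightarrow> bool" where
  "basic_subgroup B G \<longleftrightarrow>
     pure_subgroup B G \<and> direct_sum_of_cyclics (G\<lparr>carrier := B\<rparr>) \<and> divisible_group (G Mod B)"

definition fully_invariant :: "'a set \<Rightarrow> ('a, 'b) monoid_scheme \<Rightarrow> bool" where
  "fully_invariant L G \<longleftrightarrow> subgroup L G \<and> (\<forall>f\<in>hom G G. f ` L \<subseteq> L)"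

definition large_subgroup :: "'a set \<Rightarrow> ('a, 'b) monoid_scheme \<Rightarrow> bool" where
  "large_subgroup L G \<longleftrightarrow>
     fully_invariant L G \<and> (\<forall>B. basic_subgroup B G \<longrightarrow> carrier G = L <#>\<^bsub>G\<^esub> B)"

definition high_subgroup :: "nat \<Rightarrow> 'a set \<Rightarrow> ('a, 'b) monoid_scheme \<Rightarrow> bool" where
  "high_subgroup p H G \<longleftrightarrow>
     subgroup H G \<and> H \<inter> p_omega p G = {\<one>\<^bsub>G\<^esub>} \<and>
     (\<forall>K. subgroup K G \<and> K \<inter> p_omega p G = {\<one>\<^bsub>G\<^esub>} \<and> H \<subseteq> K \<longrightarrow> K = H)"

definition sigma_group :: "nat \<Rightarrow> ('a, 'b) monoid_scheme \<Rightarrow> bool" where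
  "sigma_group p G \<longleftrightarrow>
     abelian_p_group p G \<and> (\<exists>H. high_subgroup p H G \<and> direct_sum_of_cyclics (G\<lparr>carrier := H\<rparr>))"

end

theory Submission
  imports Defs "HOL-Number_Theory.Cong"
begin

text \<open>
  Everything is reduced to the socle \<open>G[p]\<close>, filtered by heights. A subset of the socle is
  height-independent if every linear combination of it has the minimum of the heights of its terms;
  dividing its elements as far as possible yields a pure direct sum of cyclic groups. By Kulikov's
  criterion, \<open>G\<close> is a \<open>\<Sigma>\<close>-group iff its socle is the union of an ascending sequence of subgroups
  \<open>P\<^sub>n\<close> for each of which \<open>P\<^sub>n \<inter> p\<^sup>mG \<subseteq> G\<^sup>1\<close> for some \<open>m\<close>. Such sequences pass between \<open>G\<close> and \<open>L\<close>
  because a large subgroup satisfies Pierce's condition: for each \<open>k\<close> there is \<open>N\<close> with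
  \<open>(p\<^sup>NG)[p\<^sup>k] \<subseteq> L\<close>; it also gives \<open>L\<^sup>1 = G\<^sup>1\<close>.

  For Pierce's condition, suppose first \<open>p\<^sup>kl \<notin> G\<^sup>1\<close> for some \<open>l \<in> L\<close>. Then \<open>G\<close> projects onto a cyclic
  summand so that the image of \<open>l\<close> has order greater than \<open>p\<^sup>k\<close>, and homomorphisms from this
  summand carry \<open>L\<close> onto \<open>(p\<^sup>NG)[p\<^sup>k]\<close>. Otherwise \<open>p\<^sup>kL \<subseteq> G\<^sup>1\<close>, hence \<open>G = G\<^sup>1 + B\<close> for every basic
  subgroup \<open>B\<close>. If \<open>B\<close> were unbounded with socle basis \<open>A\<close>, the differences of elements of \<open>A\<close> would
  span a dense subgroup of the socle that contains the socle of another basic subgroup and is too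
  small for this.
\<close>

section \<open>Primary groups\<close>

lemma (in comm_group) nat_pow_eq_mod:
  assumes "x \<in> carrier G" "x [^] (n::nat) = \<one>"
  shows "x [^] (m mod n) = x [^] m"
proof -
  have "x [^] m = x [^] (n * (m div n) + m mod n)" by simp
  also have "\<dots> = (x [^] n) [^] (m div n) \<otimes> x [^] (m mod n)"
    using assms(1) by (simp only: nat_pow_mult [symmetric] nat_pow_pow)
  finally show ?thesis using assms by simp
qed

lemma (in comm_group) subgroup_multiples: "subgroup (multiples n G) G"
proof (rule subgroupI)
  show "multiples n G \<noteq> {}" unfolding multiples_def by blast
  fix a b assume "a \<in> multiples n G" "b \<in> multiples n G"
  then obtain x y where "x \<in> carrier G" "a = x [^] n" "y \<in> carrier G" "b = y [^] n"
    unfolding multiples_def by blast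
  then show "inv a \<in> multiples n G" "a \<otimes> b \<in> multiples n G"
    unfolding multiples_def
    by (auto simp: image_iff nat_pow_inv nat_pow_distrib intro: bexI [of _ "inv x"] bexI [of _ "x \<otimes> y"])
qed (auto simp: multiples_def)

lemma (in group) multiples_1 [simp]: "multiples (Suc 0) G = carrier G"
  unfolding multiples_def by simp

lemma (in group) subgroup_nat_pow_closed:
  assumes "subgroup K G" "x \<in> K"
  shows "x [^] (n::nat) \<in> K"
  using assms by (induction n) (auto simp: subgroup.one_closed subgroup.m_closed)

lemma (in group) subgroup_mult_cancel_right:
  assumes "subgroup K G" "x \<in> carrier G" "y \<in> K" "x \<otimes> y \<in> K"
  shows "x \<in> K"
proof -
  have "x = (x \<otimes> y) \<otimes> inv y" using assms(1-3) subgroup.mem_carrier by (metis inv_solve_right m_closed)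
  then show ?thesis using assms by (metis subgroup.m_inv_closed subgroup.m_closed)
qed

lemma (in group) subgroup_mult_cancel_left:
  assumes "subgroup K G" "y \<in> carrier G" "x \<in> K" "x \<otimes> y \<in> K"
  shows "y \<in> K"
proof -
  have "y = inv x \<otimes> (x \<otimes> y)" using assms(1-3) subgroup.mem_carrier by (metis inv_solve_left m_closed)
  then show ?thesis using assms by (metis subgroup.m_inv_closed subgroup.m_closed)
qed

lemma (in group) generate_finite_support:
  assumes "z \<in> generate G A"
  obtains F where "finite F" "F \<subseteq> A" "z \<in> generate G F"
proof -
  have "\<exists>F. finite F \<and> F \<subseteq> A \<and> z \<in> generate G F"
    using assms
  proof (induction rule: generate.induct)
    case one then show ?case using generate.one by (metis empty_subsetI finite.emptyI)
  next
    case (incl h) then show ?case by (intro exI [of _ "{h}"]) (simp add: generate.incl)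
  next
    case (inv h) then show ?case by (intro exI [of _ "{h}"]) (simp add: generate.inv)
  next
    case (eng h1 h2)
    then obtain F1 F2 where "finite F1" "F1 \<subseteq> A" "h1 \<in> generate G F1"
      "finite F2" "F2 \<subseteq> A" "h2 \<in> generate G F2" by blast
    then show ?case
      using mono_generate [of F1 "F1 \<union> F2"] mono_generate [of F2 "F1 \<union> F2"]
      by (intro exI [of _ "F1 \<union> F2"]) (auto intro: generate.eng)
  qed
  then show thesis using that by blast
qed

lemma (in group) subgroup_Union_chain:
  assumes "\<C> \<noteq> {}" "\<And>K. K \<in> \<C> \<Longrightarrow> subgroup K G"
    and "\<And>K K'. K \<in> \<C> \<Longrightarrow> K' \<in> \<C> \<Longrightarrow> K \<subseteq> K' \<or> K' \<subseteq> K"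
  shows "subgroup (\<Union>\<C>) G"
proof (rule subgroupI)
  show "\<Union>\<C> \<subseteq> carrier G" using subgroup.subset [OF assms(2)] by blast
  show "\<Union>\<C> \<noteq> {}" using assms(1) subgroup.one_closed [OF assms(2)] by blast
  show "inv a \<in> \<Union>\<C>" if "a \<in> \<Union>\<C>" for a using that subgroup.m_inv_closed [OF assms(2)] by blast
  show "a \<otimes> b \<in> \<Union>\<C>" if ab: "a \<in> \<Union>\<C>" "b \<in> \<Union>\<C>" for a b
  proof -
    obtain K K' where K: "K \<in> \<C>" "a \<in> K" "K' \<in> \<C>" "b \<in> K'" using ab by blast
    then have "(K \<in> \<C> \<and> a \<in> K \<and> b \<in> K) \<or> (K' \<in> \<C> \<and> a \<in> K' \<and> b \<in> K')"
      using assms(3) [of K K'] by blast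
    then show ?thesis using subgroup.m_closed [OF assms(2)] by blast
  qed
qed

section \<open>Abelian p-groups: division prime to \<open>p\<close>, heights and the socle\<close>

locale primary_group = comm_group G for G (structure) +
  fixes p :: nat
  assumes prime_p: "Factorial_Ring.prime p"
    and torsion: "x \<in> carrier G \<Longrightarrow> \<exists>n::nat. x [^] (p ^ n) = \<one>"
begin

lemma p_gt_0: "p > 0"
  using prime_p prime_gt_0_nat by blast

lemma abelian_p_group: "abelian_p_group p G"
  unfolding abelian_p_group_def using torsion comm_group_axioms by blast

lemma primary_subgroup:
  assumes "subgroup H G"
  shows "primary_group (G\<lparr>carrier := H\<rparr>) p"
proof -
  interpret H: group "G\<lparr>carrier := H\<rparr>"
    by (rule subgroup_imp_group [OF assms])
  interpret H: comm_group "G\<lparr>carrier := H\<rparr>"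
    by (rule H.group_comm_groupI) (auto intro: m_comm dest: subgroup.mem_carrier [OF assms])
  show ?thesis
  proof
    show "\<exists>n::nat. x [^]\<^bsub>G\<lparr>carrier := H\<rparr>\<^esub> (p ^ n) = \<one>\<^bsub>G\<lparr>carrier := H\<rparr>\<^esub>"
      if "x \<in> carrier (G\<lparr>carrier := H\<rparr>)" for x
      using that torsion subgroup.mem_carrier [OF assms]
      by (simp flip: nat_pow_consistent)
  qed (rule prime_p)
qed

lemma multiples_subgroup:
  "multiples n (G\<lparr>carrier := H\<rparr>) = (\<lambda>x. x [^] n) ` H"
  unfolding multiples_def by (simp flip: nat_pow_consistent)

text \<open>Some \<open>p ^ n\<close> kills \<open>x\<close>, and \<open>k\<close> is invertible
  modulo \<open>p ^ n\<close>; the exponent \<open>j\<close> represents the inverse.\<close>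

lemma coprime_power_inverse:
  assumes "x \<in> carrier G" "\<not> p dvd k"
  obtains j :: nat where "(x [^] k) [^] j = x"
proof -
  obtain n where n: "x [^] (p ^ n) = \<one>" using torsion assms(1) by blast
  have "coprime k (p ^ n)"
    using assms(2) prime_p by (metis coprime_commute coprime_power_right_iff prime_imp_coprime)
  then obtain j where j: "[k * j = Suc 0] (mod p ^ n)"
    using cong_solve_coprime_nat by blast
  have "(x [^] k) [^] j = x [^] (k * j mod p ^ n)"
    using assms(1) n by (simp add: nat_pow_eq_mod nat_pow_pow)
  also have "\<dots> = x [^] (Suc 0 mod p ^ n)" using j by (simp add: cong_def)
  also have "\<dots> = x" using nat_pow_eq_mod [OF assms(1) n, of "Suc 0"] assms(1) by simp
  finally show thesis using that by blast
qed

text \<open>By \<open>coprime_power_inverse\<close>, \<open>x\<close> is itself a power of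
  \<open>x [^] k\<close>. This is how relations modulo a subgroup are divided by a coefficient prime
  to \<open>p\<close>.\<close>

lemma coprime_root_closed:
  assumes "subgroup K G" "x \<in> carrier G" "x [^] k \<in> K" "\<not> p dvd k"
  shows "x \<in> K"
  using assms coprime_power_inverse subgroup_nat_pow_closed by metis

abbreviation pw :: "nat \<Rightarrow> 'a set" where
  "pw n \<equiv> multiples (p ^ n) G"

abbreviation omega :: "'a set" where
  "omega \<equiv> p_omega p G"

definition socle :: "'a set" where
  "socle = {x \<in> carrier G. x [^] p = \<one>}"

lemma pw_mono: "m \<le> n \<Longrightarrow> pw n \<subseteq> pw m"
  unfolding multiples_def
  by (clarsimp simp: image_iff)
     (metis le_add_diff_inverse2 nat_pow_closed nat_pow_pow power_add)

lemma pw_0: "pw 0 = carrier G"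
  by simp

lemma pwE:
  assumes "x \<in> pw n" obtains y where "y \<in> carrier G" "x = y [^] (p ^ n)"
  using assms unfolding multiples_def by blast

lemma pwI: "y \<in> carrier G \<Longrightarrow> y [^] (p ^ n) \<in> pw n"
  unfolding multiples_def by blast

lemma pw_pow: "x \<in> pw m \<Longrightarrow> x [^] (p ^ n) \<in> pw (m + n)"
  by (elim pwE) (auto simp: nat_pow_pow simp flip: power_add intro: pwI)

lemma omega_iff: "x \<in> omega \<longleftrightarrow> (\<forall>n. x \<in> pw n)"
  unfolding p_omega_def by blast

lemma subgroup_omega: "subgroup omega G"
  unfolding p_omega_def by (rule subgroups_Inter) (auto simp: subgroup_multiples)

lemma subgroup_socle: "subgroup socle G"
  by (rule subgroupI) (auto simp: socle_def nat_pow_inv nat_pow_distrib intro: exI [of _ \<one>])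

lemma socle_carrier: "x \<in> socle \<Longrightarrow> x \<in> carrier G"
  by (simp add: socle_def)

lemma socle_pow_dvd: "x \<in> socle \<Longrightarrow> p dvd k \<Longrightarrow> x [^] k = \<one>"
  by (auto simp: socle_def simp flip: nat_pow_pow)

text \<open>Multiply by \<open>p\<close> until just before the element vanishes;
  \<open>Suc k\<close> is the exponent of the order of \<open>x\<close>.\<close>

lemma nontrivial_socle:
  assumes "subgroup K G" "x \<in> K" "x \<noteq> \<one>"
  obtains k :: nat where "x [^] (p ^ k) \<in> socle" "x [^] (p ^ k) \<noteq> \<one>"
    "x [^] (p ^ Suc k) = \<one>"
proof -
  have x: "x \<in> carrier G" by (rule subgroup.mem_carrier [OF assms(1,2)])
  obtain n where n: "x [^] (p ^ n) = \<one>" using torsion x by blast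
  define m where "m = (LEAST n. x [^] (p ^ n) = \<one>)"
  have m: "x [^] (p ^ m) = \<one>" unfolding m_def by (rule LeastI) (rule n)
  moreover have "m \<noteq> 0" using m x assms(3) by (metis nat_pow_eone power_0)
  then obtain k where k: "m = Suc k" using not0_implies_Suc by blast
  moreover have "x [^] (p ^ k) \<noteq> \<one>"
    using not_less_Least [of k "\<lambda>n. x [^] (p ^ n) = \<one>"] k unfolding m_def by auto
  moreover have "x [^] (p ^ k) \<in> socle"
    using m x k by (simp add: socle_def nat_pow_pow mult.commute)
  ultimately show thesis using that by blast
qed

text \<open>Applied to an intersection of two subgroups, this reduces a proof of disjointness to
  elements of order \<open>p\<close>.\<close>

lemma trivial_socle:
  assumes "subgroup K G" "K \<inter> socle \<subseteq> {\<one>}"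
  shows "K = {\<one>}"
proof -
  have "x = \<one>" if "x \<in> K" for x
    using nontrivial_socle [OF assms(1) that] subgroup_nat_pow_closed [OF assms(1) that] assms(2)
    by blast
  then show ?thesis using subgroup.one_closed [OF assms(1)] by blast
qed

text \<open>A natural exponent suffices because torsion turns \<open>inv x\<close> into the power
  with exponent \<open>p ^ n - 1\<close>.\<close>

lemma generate_insertE:
  assumes "x \<in> carrier G" "A \<subseteq> carrier G" "z \<in> generate G (insert x A)"
  obtains k :: nat and u where "u \<in> generate G A" "z = x [^] k \<otimes> u"
proof -
  have sub: "subgroup (generate G A) G" by (rule generate_is_subgroup [OF assms(2)])
  have "\<exists>k::nat. \<exists>u\<in>generate G A. z = x [^] k \<otimes> u"
    using assms(3)
  proof (induction rule: generate.induct)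
    case one
    then show ?case by (metis generate.one l_one nat_pow_0 one_closed)
  next
    case (incl h)
    show ?case
    proof (cases "h = x")
      case True
      then show ?thesis
        using assms(1) by (intro exI [of _ 1] bexI [of _ \<one>]) (auto simp: generate.one)
    next
      case False
      then have "h \<in> A" using incl by simp
      then show ?thesis
        using assms(2) by (intro exI [of _ 0] bexI [of _ h]) (auto simp: generate.incl)
    qed
  next
    case (inv h)
    show ?case
    proof (cases "h = x")
      case True
      obtain n where n: "x [^] (p ^ n) = \<one>" using torsion assms(1) by blast
      obtain j where j: "p ^ n = Suc j" using p_gt_0 gr0_implies_Suc by (metis zero_less_power)
      then have "x [^] j \<otimes> x = \<one>" using n assms(1) by simp
      then have "x [^] j = inv x" using assms(1) by (simp add: inv_equality)
      then show ?thesis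
        using assms(1) True by (intro exI [of _ j] bexI [of _ \<one>]) (auto simp: generate.one)
    next
      case False
      then have "h \<in> A" using inv by simp
      then show ?thesis
        using assms(2) by (intro exI [of _ 0] bexI [of _ "inv h"]) (auto simp: generate.inv)
    qed
  next
    case (eng h1 h2)
    then obtain k1 k2 :: nat and u1 u2 where
      "u1 \<in> generate G A" "u2 \<in> generate G A" "h1 = x [^] k1 \<otimes> u1" "h2 = x [^] k2 \<otimes> u2" by blast
    moreover have "u1 \<in> carrier G" "u2 \<in> carrier G"
      using calculation subgroup.mem_carrier [OF sub] by auto
    ultimately show ?case
      using assms(1)
      by (intro exI [of _ "k1 + k2"] bexI [of _ "u1 \<otimes> u2"])
         (auto simp: m_ac generate.eng simp flip: nat_pow_mult)
  qed
  then show thesis using that by blast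
qed

lemma generate_mult_pow:
  assumes "x \<in> A" "A \<subseteq> carrier G" "u \<in> generate G A"
  shows "x [^] (k::nat) \<otimes> u \<in> generate G A"
  using generate_is_subgroup [OF assms(2)] assms subgroup_nat_pow_closed subgroup.m_closed
    generate.incl by metis

end

section \<open>Height-independent sets\<close>

context primary_group
begin

text \<open>The last clause says that adding a combination of the other elements never raises the
  height of \<open>x\<close>. Coefficient 1 at \<open>x\<close> is enough, since other nonzero
  coefficients modulo \<open>p\<close> can be inverted. Excluding \<open>omega\<close> also excludes
  \<open>\<one>\<close> and makes \<open>A\<close> linearly independent.\<close>

definition height_independent :: "'a set \<Rightarrow> bool" where
  "height_independent A \<longleftrightarrow> A \<subseteq> socle \<and> A \<inter> omega = {} \<and>
     (\<forall>x\<in>A. \<forall>u\<in>generate G (A - {x}). \<forall>n. x \<otimes> u \<in> pw n \<longrightarrow> x \<in> pw n)"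

lemma height_independent_subset:
  "height_independent A \<Longrightarrow> C \<subseteq> A \<Longrightarrow> height_independent C"
  unfolding height_independent_def
  using mono_generate [of "C - {_}" "A - {_}"] by (meson Diff_mono disjoint_iff order_refl subset_iff)

lemma height_independent_carrier: "height_independent A \<Longrightarrow> A \<subseteq> carrier G"
  unfolding height_independent_def using socle_carrier by blast

lemma height_independent_generate_socle: "height_independent A \<Longrightarrow> generate G A \<subseteq> socle"
  unfolding height_independent_def using generate_subgroup_incl [OF _ subgroup_socle] by blast

lemma height_independent_empty: "height_independent {}"
  by (simp add: height_independent_def)

text \<open>Height independence has finite character: each instance of its last clause involves only
  finitely many elements, all of which lie in one member of the chain.\<close>

lemma height_independent_Union_chain:
  assumes "\<C> \<noteq> {}" "subset.chain {A. height_independent A} \<C>"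
  shows "height_independent (\<Union>\<C>)"
proof -
  have hi: "height_independent A" if "A \<in> \<C>" for A
    using that assms(2) unfolding subset.chain_def by blast
  have "x \<in> pw n" if x: "x \<in> \<Union>\<C>" and u: "u \<in> generate G (\<Union>\<C> - {x})" and xu: "x \<otimes> u \<in> pw n" for x u n
  proof -
    obtain F where F: "finite F" "F \<subseteq> \<Union>\<C> - {x}" "u \<in> generate G F"
      using generate_finite_support [OF u] by blast
    have "insert x F \<subseteq> \<Union>\<C>" using F x by blast
    then obtain A where A: "A \<in> \<C>" "insert x F \<subseteq> A"
      using finite_subset_Union_chain [OF _ _ assms] F(1) by (metis finite_insert)
    then have "u \<in> generate G (A - {x})" using F mono_generate [of F "A - {x}"] by blast
    then show ?thesis using hi [OF A(1)] A(2) xu unfolding height_independent_def by blast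
  qed
  then show ?thesis using hi unfolding height_independent_def by blast
qed

text \<open>Multiplying the combination by an inverse of \<open>k\<close> brings the coefficient of
  \<open>x\<close> to 1.\<close>

lemma height_independent_coefficient:
  assumes A: "height_independent A" "x \<in> A" "u \<in> generate G (A - {x})"
    and k: "x [^] (k::nat) \<otimes> u \<in> pw n" "\<not> p dvd k"
  shows "x \<in> pw n"
proof -
  have c: "x \<in> carrier G" "A - {x} \<subseteq> carrier G" using A height_independent_carrier by blast+
  then have u: "u \<in> carrier G" using A generate_in_carrier by blast
  obtain j :: nat where j: "(x [^] k) [^] j = x" by (rule coprime_power_inverse [OF c(1) k(2)])
  have "(x [^] k \<otimes> u) [^] j \<in> pw n"
    by (rule subgroup_nat_pow_closed [OF subgroup_multiples k(1)])
  then have "x \<otimes> u [^] j \<in> pw n" using j c u by (simp add: nat_pow_distrib)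
  moreover have "u [^] j \<in> generate G (A - {x})"
    by (rule subgroup_nat_pow_closed [OF generate_is_subgroup [OF c(2)] A(3)])
  ultimately show ?thesis using A unfolding height_independent_def by blast
qed

text \<open>A relation with coefficient prime to \<open>p\<close> at \<open>x\<close> gives a
  combination equal to \<open>\<one>\<close>, which has infinite height; this would put
  \<open>x\<close> into \<open>omega\<close>.\<close>

lemma height_independent_not_generated:
  assumes A: "height_independent A" "x \<in> A" "x [^] (k::nat) \<in> generate G (A - {x})"
  shows "p dvd k"
proof (rule ccontr)
  assume k: "\<not> p dvd k"
  have c: "x \<in> carrier G" "A - {x} \<subseteq> carrier G" using A height_independent_carrier by blast+
  have "inv (x [^] k) \<in> generate G (A - {x})" using A(3) c generate_m_inv_closed by blast
  moreover have "x [^] k \<otimes> inv (x [^] k) \<in> pw n" for n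
    using c subgroup.one_closed [OF subgroup_multiples] by simp
  ultimately have "x \<in> pw n" for n using height_independent_coefficient A k by blast
  then show False using A unfolding height_independent_def omega_iff by (metis disjoint_iff omega_iff)
qed

text \<open>This is the minimum property of heights. Split off one generator at a time from a finite
  support: if its coefficient is divisible by \<open>p\<close>, the term vanishes; otherwise the
  generator lies in \<open>pw n\<close>, and so does the remaining combination.\<close>

lemma height_independent_generate_pw:
  assumes A: "height_independent A" and s: "s \<in> generate G A" "s \<in> pw n"
  shows "s \<in> generate G (A \<inter> pw n)"
proof -
  have fin: "s \<in> generate G (F \<inter> pw n)"
    if "finite F" "height_independent F" "s \<in> generate G F" "s \<in> pw n" for F s
    using that
  proof (induction F arbitrary: s)
    case empty
    then show ?case by simp
  next
    case (insert x F)
    have c: "x \<in> carrier G" "F \<subseteq> carrier G" using insert.prems height_independent_carrier by blast+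
    have hF: "height_independent F" using insert.prems height_independent_subset by blast
    obtain k :: nat and u where u: "u \<in> generate G F" "s = x [^] k \<otimes> u"
      using generate_insertE [OF c insert.prems(2)] by blast
    have uc: "u \<in> carrier G" using u c generate_in_carrier by blast
    show ?case
    proof (cases "p dvd k")
      case True
      have "x \<in> socle" using insert.prems unfolding height_independent_def by blast
      then have "s = u" using True u uc by (simp add: socle_pow_dvd)
      then have "s \<in> generate G (F \<inter> pw n)" using insert.IH hF u insert.prems(3) by blast
      then show ?thesis using mono_generate [of "F \<inter> pw n" "insert x F \<inter> pw n"] by blast
    next
      case False
      have "x \<in> pw n"
      proof (rule height_independent_coefficient [OF insert.prems(1) _ _ _ False])
        show "u \<in> generate G (insert x F - {x})" using u insert.hyps by simp
        show "x [^] k \<otimes> u \<in> pw n" using u insert.prems by simp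
      qed simp
      moreover from this have "u \<in> pw n"
        using subgroup_mult_cancel_left [OF subgroup_multiples uc] u insert.prems(3)
          subgroup_nat_pow_closed [OF subgroup_multiples] by blast
      ultimately have "u \<in> generate G (F \<inter> pw n)" "x \<in> insert x F \<inter> pw n"
        using insert.IH hF u by auto
      then show ?thesis
        using u(2) c mono_generate [of "F \<inter> pw n" "insert x F \<inter> pw n"]
        by (auto intro!: generate_mult_pow)
    qed
  qed
  obtain F where F: "finite F" "F \<subseteq> A" "s \<in> generate G F" using generate_finite_support [OF s(1)] by blast
  then have "s \<in> generate G (F \<inter> pw n)" using fin height_independent_subset [OF A] s(2) by blast
  then show ?thesis using F mono_generate [of "F \<inter> pw n" "A \<inter> pw n"] by blast
qed

text \<open>A combination has finite support, and the heights of the elements in the support are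
  bounded by a common \<open>n\<close>; beyond it no generator is left.\<close>

lemma height_independent_generate_omega:
  assumes A: "height_independent A" and s: "s \<in> generate G A" "s \<in> omega"
  shows "s = \<one>"
proof -
  obtain F where F: "finite F" "F \<subseteq> A" "s \<in> generate G F" using generate_finite_support [OF s(1)] by blast
  have "\<forall>x\<in>F. \<exists>n. x \<notin> pw n"
  proof
    fix x assume "x \<in> F"
    then have "x \<notin> omega" using F(2) A unfolding height_independent_def by blast
    then show "\<exists>n. x \<notin> pw n" by (simp add: omega_iff)
  qed
  then obtain h where h: "\<And>x. x \<in> F \<Longrightarrow> x \<notin> pw (h x)" by metis
  \<comment> \<open>The sum serves only as an upper bound for all \<open>h x\<close>.\<close>
  define n where "n = (\<Sum>x\<in>F. h x)"
  have "x \<notin> pw n" if "x \<in> F" for x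
    using h [OF that] pw_mono [of "h x" n] member_le_sum [OF that, of h] F(1) unfolding n_def by blast
  then have "F \<inter> pw n = {}" by blast
  then show ?thesis
    using height_independent_generate_pw [OF height_independent_subset [OF A F(2)] F(3), of n]
      s(2) by (simp add: omega_iff generate_empty)
qed

text \<open>The hypothesis \<open>max\<close> says that \<open>w\<close> has maximal height in its
  coset modulo the span of \<open>A\<close>. If \<open>w\<close> occurs with a coefficient prime to
  \<open>p\<close> in a combination of height at least \<open>m\<close>, dividing by that
  coefficient gives an element of this coset. So \<open>w\<close> lies in \<open>pw m\<close> and
  its term can be removed.\<close>

lemma height_independent_insert:
  assumes A: "height_independent A" and w: "w \<in> socle" "w \<notin> pw n"
    and max: "\<And>u m. u \<in> generate G A \<Longrightarrow> w \<otimes> u \<in> pw m \<Longrightarrow> w \<in> pw m"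
  shows "height_independent (insert w A)" "w \<notin> A"
proof -
  have Ac: "A \<subseteq> carrier G" and wc: "w \<in> carrier G"
    using A height_independent_carrier w socle_carrier by auto
  show wA: "w \<notin> A"
  proof
    assume "w \<in> A"
    then have "inv w \<in> generate G A" by (rule generate.inv)
    then show False using max [of "inv w" n] w wc subgroup.one_closed [OF subgroup_multiples] by simp
  qed
  have "x \<in> pw m" if x: "x \<in> A" and u: "u \<in> generate G (insert w A - {x})" and xu: "x \<otimes> u \<in> pw m" for x u m
  proof -
    have xc: "x \<in> carrier G" using x Ac by blast
    have sub: "subgroup (generate G A) G" by (rule generate_is_subgroup [OF Ac])
    have eq: "insert w A - {x} = insert w (A - {x})" using wA x by blast
    have Axc: "A - {x} \<subseteq> carrier G" using Ac by blast
    obtain k :: nat and v where v: "v \<in> generate G (A - {x})" "u = w [^] k \<otimes> v"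
      using generate_insertE [OF wc Axc] u eq by metis
    have vc: "v \<in> carrier G" using v Axc generate_in_carrier by blast
    have vA: "v \<in> generate G A" using v mono_generate [of "A - {x}" A] by blast
    have "x \<otimes> v \<in> pw m"
    proof (cases "p dvd k")
      case True
      then show ?thesis using xu v vc w(1) by (simp add: socle_pow_dvd)
    next
      case False
      obtain j :: nat where j: "(w [^] k) [^] j = w" by (rule coprime_power_inverse [OF wc False])
      have eq2: "x \<otimes> u = w [^] k \<otimes> (x \<otimes> v)" using v wc vc xc by (simp add: m_ac)
      have "(w [^] k \<otimes> (x \<otimes> v)) [^] j \<in> pw m"
        using subgroup_nat_pow_closed [OF subgroup_multiples xu] eq2 by metis
      then have "w \<otimes> (x \<otimes> v) [^] j \<in> pw m" using j wc xc vc by (simp add: nat_pow_distrib)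
      moreover have "(x \<otimes> v) [^] j \<in> generate G A"
        using x vA generate.incl [of x A] by (intro subgroup_nat_pow_closed [OF sub] generate.eng)
      ultimately have "w \<in> pw m" using max by blast
      then have "w [^] k \<in> pw m" by (rule subgroup_nat_pow_closed [OF subgroup_multiples])
      then show ?thesis
        using subgroup_mult_cancel_left [OF subgroup_multiples _ _ xu [unfolded eq2]] xc vc by simp
    qed
    then show ?thesis using A x v unfolding height_independent_def by blast
  qed
  moreover have "w \<in> pw m" if "u \<in> generate G (insert w A - {w})" "w \<otimes> u \<in> pw m" for u m
    using that max wA by simp
  moreover have "w \<notin> omega" using w(2) omega_iff by blast
  ultimately show "height_independent (insert w A)"
    using A w(1) unfolding height_independent_def by blast
qed

text \<open>If \<open>v\<close> were not in the closure of the span, an element of maximal height in its coset modulo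
  the span could be adjoined.\<close>

lemma height_independent_maximal_dense:
  assumes S: "subgroup S G" "S \<subseteq> socle" and A0: "height_independent A0" "A0 \<subseteq> S"
  obtains A where "A0 \<subseteq> A" "A \<subseteq> S" "height_independent A"
    "\<forall>v\<in>S. \<forall>n. \<exists>u\<in>generate G A. v \<otimes> u \<in> pw n"
proof -
  define \<A> where "\<A> = {A. A0 \<subseteq> A \<and> A \<subseteq> S \<and> height_independent A}"
  have "\<exists>M\<in>\<A>. \<forall>A\<in>\<A>. M \<subseteq> A \<longrightarrow> A = M"
  proof (rule subset_Zorn_nonempty)
    show "\<A> \<noteq> {}" using A0 unfolding \<A>_def by blast
    fix \<C> assume C: "\<C> \<noteq> {}" "subset.chain \<A> \<C>"
    then have "height_independent (\<Union>\<C>)"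
      by (intro height_independent_Union_chain) (auto simp: subset.chain_def \<A>_def)
    then show "\<Union>\<C> \<in> \<A>" using C unfolding \<A>_def subset.chain_def by blast
  qed
  then obtain A where "A \<in> \<A>" and maxA: "\<forall>C\<in>\<A>. A \<subseteq> C \<longrightarrow> C = A" by blast
  then have A: "A0 \<subseteq> A" "A \<subseteq> S" "height_independent A" unfolding \<A>_def by auto
  have max: "C = A" if "A \<subseteq> C" "C \<subseteq> S" "height_independent C" for C
    using that maxA A(1) unfolding \<A>_def by blast
  have sub: "subgroup (generate G A) G"
    by (rule generate_is_subgroup [OF height_independent_carrier [OF A(3)]])
  have "\<exists>u\<in>generate G A. v \<otimes> u \<in> pw n" if v: "v \<in> S" for v n
  proof (rule ccontr)
    assume neg: "\<not> (\<exists>u\<in>generate G A. v \<otimes> u \<in> pw n)"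
    \<comment> \<open>\<open>Q m\<close> says that the coset of \<open>v\<close> contains an element
      of \<open>pw m\<close>. By \<open>neg\<close> such \<open>m\<close> are bounded by
      \<open>n\<close>, so a coset element \<open>v \<otimes> u0\<close> of greatest height
      exists.\<close>
    define Q where "Q m \<longleftrightarrow> (\<exists>u\<in>generate G A. v \<otimes> u \<in> pw m)" for m
    have vc: "v \<in> carrier G" using v S socle_carrier by blast
    have Q0: "Q 0" unfolding Q_def using generate.one [of G A] vc by (auto intro!: bexI [of _ \<one>])
    have Qb: "m \<le> n" if "Q m" for m
      using that neg pw_mono [of n m] unfolding Q_def by (metis nat_le_linear subset_iff)
    define m where "m = Greatest Q"
    have "Q m" unfolding m_def using GreatestI_nat [of Q 0 n] Q0 Qb by blast
    then obtain u0 where u0: "u0 \<in> generate G A" "v \<otimes> u0 \<in> pw m" unfolding Q_def by blast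
    have Qm: "j \<le> m" if "Q j" for j unfolding m_def using Greatest_le_nat [of Q j n] that Qb by blast
    have u0c: "u0 \<in> carrier G" using u0(1) subgroup.mem_carrier [OF sub] by blast
    have "u0 \<in> S" using u0(1) generate_subgroup_incl [OF A(2) S(1)] by blast
    then have wS: "v \<otimes> u0 \<in> S" using v subgroup.m_closed [OF S(1)] by blast
    have wmax: "v \<otimes> u0 \<in> pw j" if u: "u \<in> generate G A" "v \<otimes> u0 \<otimes> u \<in> pw j" for u j
    proof -
      have "u \<in> carrier G" using u(1) subgroup.mem_carrier [OF sub] by blast
      then have "v \<otimes> (u0 \<otimes> u) \<in> pw j" using u(2) vc u0c by (simp add: m_assoc)
      moreover have "u0 \<otimes> u \<in> generate G A" using u0(1) u(1) by (rule generate.eng)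
      ultimately have "Q j" unfolding Q_def by blast
      then show ?thesis using Qm u0(2) pw_mono by blast
    qed
    have wsoc: "v \<otimes> u0 \<in> socle" using wS S(2) by blast
    have wn: "v \<otimes> u0 \<notin> pw n" using neg u0(1) by blast
    have ins: "height_independent (insert (v \<otimes> u0) A)" "v \<otimes> u0 \<notin> A"
      using height_independent_insert [OF A(3) wsoc wn] wmax by blast+
    have "insert (v \<otimes> u0) A = A" using max [OF _ _ ins(1)] wS A(2) by blast
    then show False using ins(2) by blast
  qed
  then show thesis using that A by blast
qed

end

section \<open>Direct sums of cyclic groups\<close>

lemma (in comm_group) gfinprod_in_subgroup:
  assumes K: "subgroup K G" and f: "\<And>i. i \<in> I \<Longrightarrow> f i \<in> K"
  shows "gfinprod G f I \<in> K"
proof -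
  have "finprod G f J \<in> K" if "finite J" "J \<subseteq> I" for J
    using that
  proof (induction J)
    case empty
    then show ?case using subgroup.one_closed [OF K] by simp
  next
    case (insert i J)
    then have "f \<in> J \<rightarrow> carrier G" "f i \<in> carrier G" "f i \<in> K"
      using f subgroup.mem_carrier [OF K] by auto
    then show ?case using insert subgroup.m_closed [OF K] by simp
  qed
  \<comment> \<open>\<open>gfinprod\<close> is the product over the support when this is finite, and
    \<open>\<one>\<close> otherwise; both values lie in \<open>K\<close>.\<close>
  then show ?thesis using subgroup.one_closed [OF K] by (simp add: gfinprod_def)
qed

text \<open>This passes from the usual internal criterion to the summation map. Isolating one
  coordinate and using independence gives a trivial kernel; elements supported on one coordinate
  show that the image contains every summand.\<close>

lemma (in comm_group) direct_sum_of_cyclicsI: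
  assumes sub: "\<And>C. C \<in> \<C> \<Longrightarrow> subgroup C G"
    and cyc: "\<And>C. C \<in> \<C> \<Longrightarrow> cyclic_group (subgroup_generated G C)"
    and indep: "\<And>C. C \<in> \<C> \<Longrightarrow> C \<inter> generate G (\<Union>(\<C> - {C})) \<subseteq> {\<one>}"
    and gen: "carrier G \<subseteq> generate G (\<Union>\<C>)"
  shows "direct_sum_of_cyclics G"
proof -
  define D where "D = sum_group \<C> (\<lambda>C. subgroup_generated G C)"
  define f where "f = (\<lambda>x. gfinprod G x \<C>)"
  have grpD: "group D" unfolding D_def by simp
  have car: "carrier (subgroup_generated G C) = C" if "C \<in> \<C>" for C
    by (rule subgroup.carrier_subgroup_generated_subgroup [OF sub [OF that]])
  have Dcar: "carrier D = {x \<in> \<Pi>\<^sub>E C\<in>\<C>. C. finite {C \<in> \<C>. x C \<noteq> \<one>}}"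
    unfolding D_def using car by (subst carrier_sum_group) (auto cong: PiE_cong)
  have "(\<lambda>x. gfinprod G (\<lambda>i. (\<lambda>C x. x) i (x i)) \<C>) \<in> hom D G"
    unfolding D_def
    by (rule hom_group_sum) (auto simp: hom_def car subgroup.mem_carrier [OF sub])
  then have fhom: "f \<in> hom D G" unfolding f_def by simp
  then interpret f: group_hom D G f
    using grpD by (simp add: group_hom_def group_hom_axioms_def)
  have unC: "\<Union>(\<C> - {C}) \<subseteq> carrier G" for C using subgroup.subset [OF sub] by blast
  have split: "f x = x C \<otimes> gfinprod G x (\<C> - {C})" if C: "C \<in> \<C>" and x: "x \<in> carrier D" for x C
  proof -
    have "x \<in> \<C> - {C} \<rightarrow> carrier G" "x C \<in> carrier G"
      using C x subgroup.subset [OF sub] by (auto simp: Dcar PiE_iff)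
    moreover have "finite {i \<in> \<C> - {C}. x i \<noteq> \<one>}"
      using x by (auto simp: Dcar elim: rev_finite_subset)
    ultimately have "gfinprod G x (insert C (\<C> - {C})) = x C \<otimes> gfinprod G x (\<C> - {C})"
      by (subst gfinprod_insert) auto
    then show ?thesis using C unfolding f_def by (simp add: insert_absorb)
  qed
  have inj: "x = \<one>\<^bsub>D\<^esub>" if x: "x \<in> carrier D" and fx: "f x = \<one>" for x
  proof -
    have "x C = \<one>" if C: "C \<in> \<C>" for C
    proof -
      define r where "r = gfinprod G x (\<C> - {C})"
      have K: "subgroup (generate G (\<Union>(\<C> - {C}))) G" by (rule generate_is_subgroup [OF unC])
      have r: "r \<in> generate G (\<Union>(\<C> - {C}))"
        unfolding r_def using x
        by (intro gfinprod_in_subgroup [OF K] generate.incl) (auto simp: Dcar PiE_iff)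
      have rc: "r \<in> carrier G" by (rule subgroup.mem_carrier [OF K r])
      have xC: "x C \<in> C" using x C by (auto simp: Dcar PiE_iff)
      then have xc: "x C \<in> carrier G" using subgroup.mem_carrier [OF sub [OF C]] by blast
      have "x C \<otimes> r = \<one>" using split [OF C x] fx unfolding r_def by simp
      then have "x C = inv r" using xc rc by (metis inv_equality)
      then have "x C \<in> generate G (\<Union>(\<C> - {C}))" using subgroup.m_inv_closed [OF K r] by simp
      then show ?thesis using indep [OF C] xC by blast
    qed
    \<comment> \<open>Elements of the external sum are \<open>undefined\<close> off
      \<open>\<C>\<close>, so the coordinates in \<open>\<C>\<close> determine them.\<close>
    moreover have "x \<in> extensional \<C>" using x by (auto simp: Dcar PiE_def)
    ultimately show ?thesis unfolding D_def by (auto simp: extensional_def)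
  qed
  have img: "subgroup (f ` carrier D) G" by (rule f.img_is_subgroup)
  have "C \<subseteq> f ` carrier D" if C: "C \<in> \<C>" for C
  proof
    fix c assume c: "c \<in> C"
    define x where "x = (\<lambda>i\<in>\<C>. if i = C then c else \<one>)"
    have fin: "{i \<in> \<C>. x i \<noteq> \<one>} \<subseteq> {C}" unfolding x_def by auto
    have x: "x \<in> carrier D"
      using c C fin finite_subset [OF fin] subgroup.one_closed [OF sub]
      by (auto simp: Dcar x_def PiE_iff)
    have "gfinprod G x (\<C> - {C}) \<in> {\<one>}"
      by (rule gfinprod_in_subgroup [OF triv_subgroup]) (simp add: x_def)
    then have "f x = c" using split [OF C x] C c subgroup.mem_carrier [OF sub [OF C]] by (simp add: x_def)
    then show "c \<in> f ` carrier D" using x by blast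
  qed
  then have "generate G (\<Union>\<C>) \<subseteq> f ` carrier D"
    by (intro generate_subgroup_incl [OF _ img]) blast
  then have "f ` carrier D = carrier G" using gen subgroup.subset [OF img] by blast
  moreover have "inj_on f (carrier D)" using inj by (simp add: f.inj_on_one_iff)
  ultimately have "f \<in> iso D G" using fhom by (simp add: iso_def bij_betw_def)
  then show ?thesis
    unfolding direct_sum_of_cyclics_def D_def f_def using sub cyc by blast
qed

context primary_group
begin

text \<open>For \<open>M > 0\<close> write M = p^v c with \<open>c\<close> prime to
  \<open>p\<close>. Since p M y = 0, already p^(v+1) y = 0. As p^h y is nonzero, h is at most v, and
  \<open>M\<close> is a multiple of \<open>p ^ h\<close>.\<close>

lemma socle_of_cyclic:
  assumes y: "y \<in> carrier G" and x: "y [^] (p ^ h) \<noteq> \<one>" and M: "y [^] (M::nat) \<in> socle"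
  obtains c :: nat where "y [^] M = (y [^] (p ^ h)) [^] c"
proof (cases "M = 0")
  case True
  then show thesis using that [of 0] by simp
next
  case False
  have "\<not> is_unit p" using prime_p by (metis not_prime_unit)
  then obtain c where c: "M = p ^ multiplicity p M * c" "\<not> p dvd c"
    using multiplicity_decompose' [OF False] by blast
  define v where "v = multiplicity p M"
  have "(y [^] (p ^ Suc v)) [^] c = \<one>"
  proof -
    have "(y [^] (p ^ Suc v)) [^] c = (y [^] M) [^] p"
      using y c(1) unfolding v_def [symmetric] by (simp add: nat_pow_pow ac_simps)
    then show ?thesis using M by (simp add: socle_def)
  qed
  then have "y [^] (p ^ Suc v) \<in> {\<one>}"
    using coprime_root_closed [OF triv_subgroup _ _ c(2)] y by blast
  then have yv: "y [^] (p ^ Suc v) = \<one>" by simp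
  have "h \<le> v"
  proof (rule ccontr)
    assume "\<not> h \<le> v"
    then have "p ^ h = p ^ Suc v * p ^ (h - Suc v)" by (simp only: power_add [symmetric]) simp
    then have "y [^] (p ^ h) = (y [^] (p ^ Suc v)) [^] (p ^ (h - Suc v))"
      using y by (simp add: nat_pow_pow)
    then show False using yv x by simp
  qed
  then have "M = p ^ h * (p ^ (v - h) * c)"
    using c(1) unfolding v_def by (simp flip: power_add mult.assoc)
  then have "y [^] M = (y [^] (p ^ h)) [^] (p ^ (v - h) * c)" using y by (simp add: nat_pow_pow)
  then show thesis using that by blast
qed

text \<open>Purity can be tested on the socle. By induction on the order of \<open>b\<close>, the
  element p b has the form p^(n+1) b' with b' in \<open>B\<close>. Then b - p^n b' lies in the socle
  and in \<open>pw n\<close>, so the hypothesis applies to it. The induction raises \<open>n\<close>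
  by one, which is why \<open>n\<close> is kept arbitrary.\<close>

lemma pure_from_socle:
  assumes B: "subgroup B G"
    and soc: "\<And>n. B \<inter> socle \<inter> pw n \<subseteq> multiples (p ^ n) (G\<lparr>carrier := B\<rparr>)"
  shows "B \<inter> pw n \<subseteq> multiples (p ^ n) (G\<lparr>carrier := B\<rparr>)"
proof -
  have "b \<in> multiples (p ^ n) (G\<lparr>carrier := B\<rparr>)"
    if "b [^] (p ^ k) = \<one>" "b \<in> B" "b \<in> pw n" for b n k
    using that
  proof (induction k arbitrary: b n)
    case 0
    then have "b = \<one> [^] (p ^ n)" using subgroup.mem_carrier [OF B] by simp
    then show ?case using subgroup.one_closed [OF B] unfolding multiples_subgroup by blast
  next
    case (Suc k)
    have bc: "b \<in> carrier G" using Suc.prems subgroup.mem_carrier [OF B] by blast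
    have "(b [^] p) [^] (p ^ k) = \<one>" using Suc.prems bc by (simp add: nat_pow_pow)
    moreover have "b [^] p \<in> B" using Suc.prems subgroup_nat_pow_closed [OF B] by blast
    moreover have "b [^] p \<in> pw (Suc n)" using pw_pow [OF Suc.prems(3), of 1] by simp
    ultimately obtain b' where b': "b' \<in> B" "b [^] p = b' [^] (p ^ Suc n)"
      using Suc.IH unfolding multiples_subgroup by blast
    have b'c: "b' \<in> carrier G" using b' subgroup.mem_carrier [OF B] by blast
    define d where "d = b \<otimes> inv (b' [^] (p ^ n))"
    have b'B: "b' [^] (p ^ n) \<in> B" using b' subgroup_nat_pow_closed [OF B] by blast
    have "d \<in> B" unfolding d_def
      using Suc.prems b'B subgroup.m_closed [OF B] subgroup.m_inv_closed [OF B] by blast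
    moreover have "d [^] p = \<one>"
      using b'(2) bc b'c unfolding d_def by (simp add: nat_pow_distrib nat_pow_inv nat_pow_pow mult.commute)
    moreover have "d \<in> pw n"
      unfolding d_def using Suc.prems(3) pwI [OF b'c, of n]
        subgroup.m_closed [OF subgroup_multiples] subgroup.m_inv_closed [OF subgroup_multiples] by blast
    ultimately have "d \<in> multiples (p ^ n) (G\<lparr>carrier := B\<rparr>)"
      using soc [of n] bc b'c unfolding socle_def d_def by auto
    then obtain e where e: "e \<in> B" "d = e [^] (p ^ n)" unfolding multiples_subgroup by blast
    have ec: "e \<in> carrier G" using e subgroup.mem_carrier [OF B] by blast
    have "b = d \<otimes> b' [^] (p ^ n)" unfolding d_def using bc b'c by (simp add: m_assoc)
    then have "b = (e \<otimes> b') [^] (p ^ n)" using e ec b'c by (simp add: nat_pow_distrib)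
    then show ?case using e b' subgroup.m_closed [OF B] unfolding multiples_subgroup by blast
  qed
  then show ?thesis using torsion subgroup.mem_carrier [OF B] by (meson IntE subsetI)
qed

lemma height_independent_height:
  assumes "height_independent A" "x \<in> A"
  obtains y h where "y \<in> carrier G" "x = y [^] (p ^ h)" "x \<notin> pw (Suc h)"
proof -
  have "x \<notin> omega" "x \<in> carrier G"
    using assms height_independent_carrier unfolding height_independent_def by blast+
  then obtain n where n: "x \<notin> pw n" by (auto simp: omega_iff)
  define m where "m = (LEAST n. x \<notin> pw n)"
  have m: "x \<notin> pw m" unfolding m_def by (rule LeastI) (rule n)
  then have "m \<noteq> 0" using \<open>x \<in> carrier G\<close> by (metis pw_0)
  then obtain h where h: "m = Suc h" using not0_implies_Suc by blast
  then have "x \<in> pw h" using not_less_Least [of h "\<lambda>n. x \<notin> pw n"] unfolding m_def by auto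
  then show thesis using that m h by (metis pwE)
qed

text \<open>If \<open>y [^] m\<close> were nontrivial, one of its multiples would be a nontrivial
  socle element of the cyclic group of \<open>y\<close>, hence a multiple of \<open>x\<close>, and
  also a combination of \<open>F\<close>. This contradicts the independence of \<open>x\<close> from
  \<open>F\<close>. The lemma serves both to compute the socle of the group generated by the roots
  and to separate its cyclic summands.\<close>

lemma cyclic_independent_step:
  assumes F: "F \<subseteq> A" "Y F \<inter> socle \<subseteq> generate G F" "subgroup (Y F) G"
    and A: "height_independent A" "x \<in> A - F"
    and y: "y \<in> carrier G" "y [^] (p ^ h) = x" and m: "y [^] (m::nat) \<in> Y F"
  shows "y [^] m = \<one>"
proof (rule ccontr)
  assume "y [^] m \<noteq> \<one>"
  then obtain j :: nat where j: "(y [^] m) [^] (p ^ j) \<in> socle" "(y [^] m) [^] (p ^ j) \<noteq> \<one>"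
    using nontrivial_socle [OF F(3) m] by blast
  have x: "x \<in> socle" "x \<notin> omega" using A unfolding height_independent_def by blast+
  then have "x \<noteq> \<one>" using subgroup.one_closed [OF subgroup_omega] by blast
  have eq: "(y [^] m) [^] (p ^ j) = y [^] (m * p ^ j)" using y by (simp add: nat_pow_pow)
  have "y [^] (p ^ h) \<noteq> \<one>" "y [^] (m * p ^ j) \<in> socle" using y(2) \<open>x \<noteq> \<one>\<close> j(1) eq by auto
  then obtain c :: nat where "y [^] (m * p ^ j) = (y [^] (p ^ h)) [^] c" by (rule socle_of_cyclic [OF y(1)])
  then have c: "y [^] (m * p ^ j) = x [^] c" using y(2) by simp
  have "(y [^] m) [^] (p ^ j) \<in> generate G F"
    using F(2) j(1) subgroup_nat_pow_closed [OF F(3) m] by blast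
  then have "x [^] c \<in> generate G (A - {x})"
    using c eq mono_generate [of F "A - {x}"] F(1) A(2) by auto
  then have "p dvd c" using height_independent_not_generated A by blast
  then show False using socle_pow_dvd [OF x(1)] j(2) c eq by metis
qed

text \<open>Each \<open>x\<close> in \<open>A\<close> of exact height \<open>h x\<close> is divided
  by \<open>p ^ h x\<close> to give \<open>y x\<close>, and \<open>B\<close> is generated by these
  roots. Its socle is the span of \<open>A\<close>, so by the minimum property every socle element
  of \<open>B\<close> that has height at least \<open>n\<close> in \<open>G\<close> is a combination
  of elements of \<open>A\<close> divisible by \<open>p ^ n\<close> inside \<open>B\<close>.\<close>

lemma height_independent_basis:
  assumes A: "height_independent A"
  obtains B where "subgroup B G" "B \<inter> socle = generate G A"
    "\<And>n. B \<inter> pw n \<subseteq> multiples (p ^ n) (G\<lparr>carrier := B\<rparr>)"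
    "direct_sum_of_cyclics (G\<lparr>carrier := B\<rparr>)"
proof -
  have "\<forall>x\<in>A. \<exists>y h. y \<in> carrier G \<and> x = y [^] (p ^ h) \<and> x \<notin> pw (Suc h)"
    using height_independent_height [OF A] by metis
  then obtain y h where y: "\<And>x. x \<in> A \<Longrightarrow> y x \<in> carrier G"
    and yh: "\<And>x. x \<in> A \<Longrightarrow> y x [^] (p ^ h x) = x" and h: "\<And>x. x \<in> A \<Longrightarrow> x \<notin> pw (Suc (h x))"
    by metis
  define Y where "Y F = generate G (y ` F)" for F
  have Ysub: "subgroup (Y F) G" if "F \<subseteq> A" for F
    unfolding Y_def using y that by (intro generate_is_subgroup) blast
  have Ac: "A \<subseteq> carrier G" by (rule height_independent_carrier [OF A])
  have Ysoc_fin: "Y F \<inter> socle \<subseteq> generate G F" if "finite F" "F \<subseteq> A" for F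
    using that
  proof (induction F)
    case empty
    then show ?case by (simp add: Y_def generate_empty)
  next
    case (insert x F)
    show ?case
    proof
      fix z assume z: "z \<in> Y (insert x F) \<inter> socle"
      have xF: "F \<subseteq> A" "x \<in> A - F" "x \<in> A" "F \<subseteq> carrier G" "insert x F \<subseteq> carrier G"
        using insert Ac by auto
      have IH: "Y F \<inter> socle \<subseteq> generate G F" using insert by blast
      have yF: "y ` F \<subseteq> carrier G" using y xF by blast
      have yx: "y x \<in> carrier G" using y xF by blast
      have "z \<in> generate G (insert (y x) (y ` F))" using z unfolding Y_def by simp
      then obtain k :: nat and u where u: "u \<in> Y F" "z = y x [^] k \<otimes> u"
        unfolding Y_def by (rule generate_insertE [OF yx yF])
      have uc: "u \<in> carrier G" using u(1) subgroup.mem_carrier [OF Ysub [OF xF(1)]] by blast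
      \<comment> \<open>Multiplying by \<open>p\<close> moves p k (y x) into \<open>Y F\<close>,
        where it must vanish. Thus both terms of \<open>z\<close> lie in the socle separately: the
        first is a multiple of \<open>x\<close>, the second falls under the induction
        hypothesis.\<close>
      have "(y x [^] k \<otimes> u) [^] p = \<one>" using z u(2) by (simp add: socle_def)
      then have eq: "y x [^] (k * p) \<otimes> u [^] p = \<one>" using yx uc by (simp add: nat_pow_distrib nat_pow_pow)
      then have "y x [^] (k * p) = inv (u [^] p)" using yx uc by (metis inv_equality nat_pow_closed)
      then have "y x [^] (k * p) \<in> Y F"
        using u(1) subgroup.m_inv_closed [OF Ysub [OF xF(1)]] subgroup_nat_pow_closed [OF Ysub [OF xF(1)]]
        by metis
      then have one: "y x [^] (k * p) = \<one>"
        using cyclic_independent_step [of F A Y, OF xF(1) IH Ysub [OF xF(1)] A xF(2) yx yh [OF xF(3)]]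
        by blast
      then have "u \<in> socle" using eq uc by (simp add: socle_def)
      then have uF: "u \<in> generate G F" using IH u(1) by blast
      have "x \<noteq> \<one>"
        using A xF(3) subgroup.one_closed [OF subgroup_omega] unfolding height_independent_def by blast
      moreover have "y x [^] k \<in> socle" using one yx by (simp add: socle_def nat_pow_pow)
      ultimately obtain c :: nat where "y x [^] k = x [^] c"
        using socle_of_cyclic [OF yx, of "h x" k] yh [OF xF(3)] by metis
      then show "z \<in> generate G (insert x F)"
        using u(2) uF mono_generate [of F "insert x F"] generate_mult_pow [OF _ xF(5)] by auto
    qed
  qed
  have Ysoc: "Y F \<inter> socle \<subseteq> generate G F" if F: "F \<subseteq> A" for F
  proof
    fix z assume z: "z \<in> Y F \<inter> socle"
    then obtain E where E: "finite E" "E \<subseteq> y ` F" "z \<in> generate G E"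
      using generate_finite_support [of z "y ` F"] unfolding Y_def by blast
    then obtain E' where E': "finite E'" "E' \<subseteq> F" "E = y ` E'" using finite_subset_image by metis
    then have "z \<in> generate G E'" using Ysoc_fin [of E'] F E z unfolding Y_def by blast
    then show "z \<in> generate G F" using mono_generate E'(2) by blast
  qed
  define B where "B = Y A"
  have B: "subgroup B G" unfolding B_def using Ysub by blast
  have yB: "y x \<in> B" if "x \<in> A" for x unfolding B_def Y_def using that by (simp add: generate.incl)
  have AB: "A \<subseteq> B" using yB yh subgroup_nat_pow_closed [OF B] by (metis subsetI)
  have socB: "B \<inter> socle = generate G A"
    using Ysoc [of A] generate_subgroup_incl [OF AB B] height_independent_generate_socle [OF A]
    unfolding B_def by blast
  interpret B: primary_group "G\<lparr>carrier := B\<rparr>" p by (rule primary_subgroup [OF B])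
  have "B \<inter> socle \<inter> pw n \<subseteq> multiples (p ^ n) (G\<lparr>carrier := B\<rparr>)" for n
  proof
    fix s assume "s \<in> B \<inter> socle \<inter> pw n"
    then have s: "s \<in> generate G (A \<inter> pw n)" using height_independent_generate_pw [OF A] socB by blast
    have M: "subgroup (multiples (p ^ n) (G\<lparr>carrier := B\<rparr>)) G"
      by (rule incl_subgroup [OF B B.subgroup_multiples])
    have "x \<in> multiples (p ^ n) (G\<lparr>carrier := B\<rparr>)" if x: "x \<in> A \<inter> pw n" for x
    proof -
      \<comment> \<open>Here exactness of the height is used: the chosen root \<open>y x\<close>
        absorbs at least \<open>n\<close> divisions by \<open>p\<close>.\<close>
      have "n \<le> h x" using h [of x] x pw_mono [of "Suc (h x)" n] by (meson IntD1 IntD2 not_less_eq_eq subset_iff)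
      then have "x = (y x [^] (p ^ (h x - n))) [^] (p ^ n)"
        using yh [of x] y [of x] x by (simp add: nat_pow_pow flip: power_add)
      moreover have "y x [^] (p ^ (h x - n)) \<in> B" using yB x subgroup_nat_pow_closed [OF B] by blast
      ultimately show ?thesis unfolding multiples_subgroup by blast
    qed
    then have "A \<inter> pw n \<subseteq> multiples (p ^ n) (G\<lparr>carrier := B\<rparr>)" by blast
    then show "s \<in> multiples (p ^ n) (G\<lparr>carrier := B\<rparr>)" using s generate_subgroup_incl [OF _ M] by blast
  qed
  then have pure: "B \<inter> pw n \<subseteq> multiples (p ^ n) (G\<lparr>carrier := B\<rparr>)" for n
    by (rule pure_from_socle [OF B])
  define \<C> where "\<C> = (\<lambda>x. generate G {y x}) ` A"
  have gB: "generate (G\<lparr>carrier := B\<rparr>) K = generate G K" if "K \<subseteq> B" for K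
    by (rule generate_consistent [OF that B])
  have CB: "generate G {y x} \<subseteq> B" if "x \<in> A" for x
    using generate_subgroup_incl [OF _ B] yB [OF that] by blast
  have "direct_sum_of_cyclics (G\<lparr>carrier := B\<rparr>)"
  proof (rule B.direct_sum_of_cyclicsI [where \<C> = \<C>])
    fix C assume "C \<in> \<C>"
    then obtain x where x: "x \<in> A" and C: "C = generate G {y x}" unfolding \<C>_def by blast
    have C': "C = generate (G\<lparr>carrier := B\<rparr>) {y x}" using gB [of "{y x}"] yB x C by simp
    show sC: "subgroup C (G\<lparr>carrier := B\<rparr>)"
      unfolding C' by (rule B.generate_is_subgroup) (use yB x in simp)
    have "subgroup_generated (G\<lparr>carrier := B\<rparr>) C = subgroup_generated (G\<lparr>carrier := B\<rparr>) {y x}"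
      using subgroup.carrier_subgroup_generated_subgroup [OF sC] yB [OF x] C'
      unfolding subgroup_generated_def by simp
    then show "cyclic_group (subgroup_generated (G\<lparr>carrier := B\<rparr>) C)"
      using B.cyclic_group_generated by simp
    have "\<Union>(\<C> - {C}) \<subseteq> Y (A - {x})"
    proof -
      have "generate G {y x'} \<subseteq> Y (A - {x})" if "x' \<in> A - {x}" for x'
        unfolding Y_def using that by (intro mono_generate) blast
      then show ?thesis unfolding \<C>_def C by blast
    qed
    moreover have UB: "\<Union>(\<C> - {C}) \<subseteq> B" unfolding \<C>_def using CB by blast
    ultimately have U: "generate (G\<lparr>carrier := B\<rparr>) (\<Union>(\<C> - {C})) \<subseteq> Y (A - {x})"
      using gB [OF UB] generate_subgroup_incl [OF _ Ysub [of "A - {x}"]] by auto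
    show "C \<inter> generate (G\<lparr>carrier := B\<rparr>) (\<Union>(\<C> - {C})) \<subseteq> {\<one>\<^bsub>G\<lparr>carrier := B\<rparr>\<^esub>}"
    proof
      fix z assume z: "z \<in> C \<inter> generate (G\<lparr>carrier := B\<rparr>) (\<Union>(\<C> - {C}))"
      then obtain m :: nat where m: "z = y x [^] m"
        using generate_insertE [of "y x" "{}" z] y [OF x] unfolding C
        by (auto simp: generate_empty)
      have "y x [^] m \<in> Y (A - {x})" using z m U by blast
      then have "y x [^] m = \<one>"
        using cyclic_independent_step [of "A - {x}" A Y, OF _ Ysoc Ysub A _ y [OF x] yh [OF x]] x
        by blast
      then show "z \<in> {\<one>\<^bsub>G\<lparr>carrier := B\<rparr>\<^esub>}" using m by simp
    qed
  next
    have "\<Union>\<C> \<subseteq> B" unfolding \<C>_def using CB by blast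
    moreover have "y ` A \<subseteq> \<Union>\<C>" unfolding \<C>_def by (auto intro: generate.incl)
    ultimately show "carrier (G\<lparr>carrier := B\<rparr>) \<subseteq> generate (G\<lparr>carrier := B\<rparr>) (\<Union>\<C>)"
      using gB mono_generate unfolding B_def Y_def by simp
  qed
  then show thesis using that B socB pure by blast
qed

end

section \<open>Kulikov's criterion and high subgroups\<close>

context primary_group
begin

lemma multiples_subgroup_subset: "H \<subseteq> carrier G \<Longrightarrow> multiples n (G\<lparr>carrier := H\<rparr>) \<subseteq> multiples n G"
  unfolding multiples_subgroup by (auto simp: multiples_def)

lemma subgroup_socle_restrict:
  assumes "subgroup H G"
  shows "primary_group.socle (G\<lparr>carrier := H\<rparr>) p = socle \<inter> H"
proof -
  interpret H: primary_group "G\<lparr>carrier := H\<rparr>" p by (rule primary_subgroup [OF assms])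
  show ?thesis
    using subgroup.subset [OF assms] unfolding H.socle_def socle_def
    by (auto simp flip: nat_pow_consistent)
qed

text \<open>Induction on the order: p^k x lies in the socle, hence in \<open>B\<close>, and purity
  writes it as p^k b with b in \<open>B\<close>. Then x - b is killed by
  \<open>p ^ k\<close>.\<close>

lemma pure_containing_socle:
  assumes B: "subgroup B G" "socle \<subseteq> B"
    and pure: "\<And>n. B \<inter> pw n \<subseteq> multiples (p ^ n) (G\<lparr>carrier := B\<rparr>)"
  shows "B = carrier G"
proof -
  have "x \<in> B" if "x \<in> carrier G" "x [^] (p ^ k) = \<one>" for x k
    using that
  proof (induction k arbitrary: x)
    case 0
    then show ?case using subgroup.one_closed [OF B(1)] by simp
  next
    case (Suc k)
    have "x [^] (p ^ k) \<in> socle" using Suc.prems by (simp add: socle_def nat_pow_pow mult.commute)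
    then have "x [^] (p ^ k) \<in> multiples (p ^ k) (G\<lparr>carrier := B\<rparr>)"
      using B(2) pure [of k] pwI [OF Suc.prems(1)] by blast
    then obtain b where b: "b \<in> B" "x [^] (p ^ k) = b [^] (p ^ k)" unfolding multiples_subgroup by blast
    have bc: "b \<in> carrier G" by (rule subgroup.mem_carrier [OF B(1) b(1)])
    have "(x \<otimes> inv b) [^] (p ^ k) = \<one>"
      using b bc Suc.prems(1) by (simp add: nat_pow_distrib nat_pow_inv)
    then have "x \<otimes> inv b \<in> B" using Suc.IH bc Suc.prems(1) by simp
    then show ?case
      by (rule subgroup_mult_cancel_right [OF B(1) Suc.prems(1) subgroup.m_inv_closed [OF B(1) b(1)]])
  qed
  then show ?thesis using torsion subgroup.subset [OF B(1)] by (meson subset_antisym subsetI)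
qed

text \<open>Kulikov's criterion: a height-independent basis of each \<open>S n\<close> extends to one of \<open>S (Suc n)\<close>.\<close>

lemma kulikov:
  assumes S: "\<And>n. subgroup (S n) G" "\<And>n::nat. S n \<subseteq> S (Suc n)" "(\<Union>n. S n) = socle"
    and bounded: "\<And>n. \<exists>m. S n \<inter> pw m \<subseteq> {\<one>}"
  shows "direct_sum_of_cyclics G"
proof -
  define P where "P n A \<longleftrightarrow> height_independent A \<and> A \<subseteq> S n \<and> S n \<subseteq> generate G A" for n A
  \<comment> \<open>Because \<open>S n\<close> meets some \<open>pw m\<close> trivially, a span that
    is dense in \<open>S n\<close> for the heights is all of \<open>S n\<close>.\<close>
  have ext: "\<exists>A. P n A \<and> A0 \<subseteq> A" if A0: "height_independent A0" "A0 \<subseteq> S n" for n A0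
  proof -
    have Sn: "S n \<subseteq> socle" using S(3) by blast
    obtain m where m: "S n \<inter> pw m \<subseteq> {\<one>}" using bounded by blast
    obtain A where A: "A0 \<subseteq> A" "A \<subseteq> S n" "height_independent A"
      and dense: "\<forall>v\<in>S n. \<forall>k. \<exists>u\<in>generate G A. v \<otimes> u \<in> pw k"
      by (rule height_independent_maximal_dense [OF S(1) Sn A0])
    have "v \<in> generate G A" if v: "v \<in> S n" for v
    proof -
      obtain u where u: "u \<in> generate G A" "v \<otimes> u \<in> pw m" using dense v by blast
      have uS: "u \<in> S n" using u(1) generate_subgroup_incl [OF A(2) S(1)] by blast
      then have "v \<otimes> u \<in> S n" using v subgroup.m_closed [OF S(1)] by blast
      then have "v \<otimes> u = \<one>" using u(2) m by blast
      then have "v = inv u" using v uS subgroup.mem_carrier [OF S(1)] by (metis inv_equality)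
      then show ?thesis
        using u(1) subgroup.m_inv_closed [OF generate_is_subgroup [OF height_independent_carrier [OF A(3)]]]
        by simp
    qed
    then show ?thesis using A unfolding P_def by blast
  qed
  \<comment> \<open>The bases have to be chosen nested, so that their union is again
    height-independent.\<close>
  have "\<exists>f. \<forall>n. P n (f n) \<and> f n \<subseteq> f (Suc n)"
  proof (rule dependent_nat_choice)
    show "\<exists>A. P 0 A" using ext [OF height_independent_empty] by blast
    show "\<exists>C. P (Suc n) C \<and> A \<subseteq> C" if "P n A" for A n
      using ext [of A "Suc n"] that S(2) [of n] unfolding P_def by blast
  qed
  then obtain f where f: "\<And>n. P n (f n)" "\<And>n. f n \<subseteq> f (Suc n)" by blast
  define A where "A = (\<Union>n. f n)"
  have mono: "f m \<subseteq> f n" if "m \<le> n" for m n using lift_Suc_mono_le [of f] f(2) that by blast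
  have "subset.chain {A. height_independent A} (range f)"
  proof -
    have "f m \<subseteq> f n \<or> f n \<subseteq> f m" for m n using mono by (meson nat_le_linear)
    then show ?thesis using f(1) unfolding subset_chain_def P_def by blast
  qed
  then have A: "height_independent A" unfolding A_def by (intro height_independent_Union_chain) auto
  have "S n \<subseteq> generate G A" for n
    using f(1) [of n] mono_generate [of "f n" A] unfolding P_def A_def by blast
  then have "socle \<subseteq> generate G A" using S(3) by blast
  moreover obtain B where B: "subgroup B G" "B \<inter> socle = generate G A"
    "\<And>n. B \<inter> pw n \<subseteq> multiples (p ^ n) (G\<lparr>carrier := B\<rparr>)"
    "direct_sum_of_cyclics (G\<lparr>carrier := B\<rparr>)"
    using height_independent_basis [OF A] by blast
  ultimately have "B = carrier G" using pure_containing_socle [OF B(1) _ B(3)] by blast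
  then show ?thesis using B(4) by simp
qed

section \<open>Subgroups maximal among those disjoint from a given one, and high subgroups\<close>

text \<open>Zorn's lemma. It is applied with \<open>C\<close> equal to \<open>omega\<close> (high
  subgroups), to a cyclic group (complements), and to the part of the socle in \<open>pw N\<close>
  (the final transfer).\<close>

lemma maximal_disjoint_subgroup:
  assumes K0: "subgroup K0 G" "K0 \<inter> C = {\<one>}"
  obtains M where "subgroup M G" "K0 \<subseteq> M" "M \<inter> C = {\<one>}"
    "\<forall>K. subgroup K G \<longrightarrow> K \<inter> C = {\<one>} \<longrightarrow> M \<subseteq> K \<longrightarrow> K = M"
proof -
  define \<A> where "\<A> = {K. subgroup K G \<and> K0 \<subseteq> K \<and> K \<inter> C = {\<one>}}"
  have "\<exists>M\<in>\<A>. \<forall>K\<in>\<A>. M \<subseteq> K \<longrightarrow> K = M"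
  proof (rule subset_Zorn_nonempty)
    show "\<A> \<noteq> {}" using K0 unfolding \<A>_def by blast
    fix \<C> assume C: "\<C> \<noteq> {}" "subset.chain \<A> \<C>"
    then have sub: "K \<in> \<A>" if "K \<in> \<C>" for K using that unfolding subset_chain_def by blast
    have "subgroup (\<Union>\<C>) G"
    proof (rule subgroup_Union_chain [OF C(1)])
      show "subgroup K G" if "K \<in> \<C>" for K using sub [OF that] unfolding \<A>_def by blast
      show "K \<subseteq> K' \<or> K' \<subseteq> K" if "K \<in> \<C>" "K' \<in> \<C>" for K K'
        using that C(2) unfolding subset_chain_def by blast
    qed
    moreover have "\<Union>\<C> \<inter> C = {\<one>}" "K0 \<subseteq> \<Union>\<C>" using sub C(1) unfolding \<A>_def by blast+
    ultimately show "\<Union>\<C> \<in> \<A>" unfolding \<A>_def by blast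
  qed
  then obtain M where M: "M \<in> \<A>" and max: "\<forall>K\<in>\<A>. M \<subseteq> K \<longrightarrow> K = M" by blast
  have maxK: "K = M" if "subgroup K G" "K \<inter> C = {\<one>}" "M \<subseteq> K" for K
  proof -
    have "K0 \<subseteq> K" using M that(3) unfolding \<A>_def by blast
    then have "K \<in> \<A>" using that unfolding \<A>_def by simp
    then show ?thesis using max that(3) by blast
  qed
  show thesis by (rule that [of M]) (use M maxK in \<open>auto simp: \<A>_def\<close>)
qed

lemma maximal_disjoint_meets:
  assumes M: "subgroup M G" and C: "\<one> \<in> C"
    and max: "\<And>K. subgroup K G \<Longrightarrow> K \<inter> C = {\<one>} \<Longrightarrow> M \<subseteq> K \<Longrightarrow> K = M"
    and x: "x \<in> carrier G" "x \<notin> M"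
  obtains j :: nat and u where "u \<in> M" "x [^] j \<otimes> u \<in> C" "x [^] j \<otimes> u \<noteq> \<one>"
proof -
  define K where "K = generate G (insert x M)"
  have Mc: "M \<subseteq> carrier G" by (rule subgroup.subset [OF M])
  have K: "subgroup K G" unfolding K_def using Mc x(1) by (intro generate_is_subgroup) blast
  have MK: "M \<subseteq> K" "x \<in> K" unfolding K_def by (auto intro: generate.incl)
  then have "K \<inter> C \<noteq> {\<one>}" using max [OF K] x(2) by blast
  then obtain z where z: "z \<in> K" "z \<in> C" "z \<noteq> \<one>" using C subgroup.one_closed [OF K] by blast
  then obtain j :: nat and u where "u \<in> generate G M" "z = x [^] j \<otimes> u"
    using generate_insertE [OF x(1) Mc] unfolding K_def by blast
  moreover have "generate G M \<subseteq> M" by (rule generate_subgroup_incl [OF order_refl M])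
  ultimately show thesis using that z by blast
qed

text \<open>If \<open>p\<close> divided \<open>j\<close>, then \<open>x [^] j\<close>, and with it
  the whole element of \<open>C\<close>, would lie in \<open>M\<close>, against disjointness. So the
  relation can be divided by \<open>j\<close>.\<close>

lemma maximal_disjoint_meets_coprime:
  assumes M: "subgroup M G" and C: "\<one> \<in> C" "M \<inter> C = {\<one>}"
    and max: "\<And>K. subgroup K G \<Longrightarrow> K \<inter> C = {\<one>} \<Longrightarrow> M \<subseteq> K \<Longrightarrow> K = M"
    and x: "x \<in> carrier G" "x \<notin> M" "x [^] p \<in> M"
  obtains j :: nat and u where "u \<in> M" "x [^] j \<otimes> u \<in> C" "\<not> p dvd j"
proof -
  obtain j :: nat and u where u: "u \<in> M" "x [^] j \<otimes> u \<in> C" "x [^] j \<otimes> u \<noteq> \<one>"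
    by (rule maximal_disjoint_meets [OF M C(1) max x(1,2)])
  have "\<not> p dvd j"
  proof
    assume "p dvd j"
    then obtain c where "j = p * c" by blast
    then have "x [^] j = (x [^] p) [^] c" using x(1) by (simp add: nat_pow_pow)
    then have "x [^] j \<in> M" using subgroup_nat_pow_closed [OF M x(3)] by simp
    then have "x [^] j \<otimes> u \<in> M" using u(1) by (rule subgroup.m_closed [OF M])
    then show False using u C(2) by blast
  qed
  then show thesis using that u by blast
qed

text \<open>For \<open>x\<close> in the socle, \<open>x [^] p\<close> is trivially in
  \<open>M\<close>. The previous lemma puts a multiple of \<open>x\<close> prime to \<open>p\<close>
  into \<open>M <#> C\<close>, and hence \<open>x\<close> itself.\<close>

lemma maximal_disjoint_socle:
  assumes M: "subgroup M G" and C: "subgroup C G" "M \<inter> C = {\<one>}"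
    and max: "\<And>K. subgroup K G \<Longrightarrow> K \<inter> C = {\<one>} \<Longrightarrow> M \<subseteq> K \<Longrightarrow> K = M"
  shows "socle \<subseteq> M <#> C"
proof
  have MC: "subgroup (M <#> C) G" by (rule mult_subgroups [OF M C(1)])
  fix x assume x: "x \<in> socle"
  show "x \<in> M <#> C"
  proof (cases "x \<in> M")
    case True
    then have "x = x \<otimes> \<one>" using socle_carrier [OF x] by simp
    then show ?thesis using True subgroup.one_closed [OF C(1)] unfolding set_mult_def by blast
  next
    case False
    have xp: "x [^] p \<in> M" using x subgroup.one_closed [OF M] by (simp add: socle_def)
    obtain j :: nat and u where u: "u \<in> M" "x [^] j \<otimes> u \<in> C" "\<not> p dvd j"
      by (rule maximal_disjoint_meets_coprime
          [OF M subgroup.one_closed [OF C(1)] C(2) max socle_carrier [OF x] False xp])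
    have uc: "u \<in> carrier G" "x \<in> carrier G" using u(1) subgroup.mem_carrier [OF M] socle_carrier [OF x] by auto
    have "x [^] j = inv u \<otimes> (x [^] j \<otimes> u)" using uc by (simp add: m_ac(2,3) flip: m_assoc)
    moreover have "inv u \<in> M" by (rule subgroup.m_inv_closed [OF M u(1)])
    ultimately have "x [^] j \<in> M <#> C" using u(2) unfolding set_mult_def by blast
    then show ?thesis using coprime_root_closed [OF MC uc(2) _ u(3)] by blast
  qed
qed

lemma high_subgroup_exists: obtains H where "high_subgroup p H G"
proof -
  have "{\<one>} \<inter> omega = {\<one>}" using subgroup.one_closed [OF subgroup_omega] by blast
  then obtain H where H: "subgroup H G" "{\<one>} \<subseteq> H" "H \<inter> omega = {\<one>}"
    and max: "\<forall>K. subgroup K G \<longrightarrow> K \<inter> omega = {\<one>} \<longrightarrow> H \<subseteq> K \<longrightarrow> K = H"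
    by (rule maximal_disjoint_subgroup [OF triv_subgroup])
  have "high_subgroup p H G" unfolding high_subgroup_def using H(1,3) max by blast
  then show thesis by (rule that)
qed

lemma high_subgroup_maximal:
  "high_subgroup p H G \<Longrightarrow> subgroup K G \<Longrightarrow> K \<inter> omega = {\<one>} \<Longrightarrow> H \<subseteq> K \<Longrightarrow> K = H"
  unfolding high_subgroup_def by blast

lemma high_subgroup_socle:
  assumes H: "high_subgroup p H G"
  shows "socle \<subseteq> H <#> omega"
proof -
  have "subgroup H G" "H \<inter> omega = {\<one>}" using H unfolding high_subgroup_def by auto
  then show ?thesis by (rule maximal_disjoint_socle [OF _ subgroup_omega _ high_subgroup_maximal [OF H]])
qed

text \<open>Let h = p^(n+1) g and x = p^n g. If \<open>x\<close> is not in \<open>H\<close>,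
  maximality gives j x + u in \<open>omega\<close> with u in \<open>H\<close> and \<open>j\<close>
  prime to \<open>p\<close>. Then u lies in \<open>pw n\<close>, so u = p^n b with b in
  \<open>H\<close> by induction. Multiplying by \<open>p\<close> gives j h + p^(n+1) b, which lies
  in both \<open>H\<close> and \<open>omega\<close> and vanishes; dividing by \<open>j\<close>
  finishes the proof.\<close>

lemma high_subgroup_pure:
  assumes H: "high_subgroup p H G"
  shows "H \<inter> pw n \<subseteq> multiples (p ^ n) (G\<lparr>carrier := H\<rparr>)"
proof (induction n)
  case 0
  have "subgroup H G" using H unfolding high_subgroup_def by auto
  then show ?case using subgroup.mem_carrier unfolding multiples_subgroup by fastforce
next
  case (Suc n)
  have sub: "subgroup H G" "H \<inter> omega = {\<one>}" using H unfolding high_subgroup_def by auto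
  interpret H: primary_group "G\<lparr>carrier := H\<rparr>" p by (rule primary_subgroup [OF sub(1)])
  have M: "subgroup (multiples (p ^ Suc n) (G\<lparr>carrier := H\<rparr>)) G"
    by (rule incl_subgroup [OF sub(1) H.subgroup_multiples])
  show ?case
  proof
    fix h assume h: "h \<in> H \<inter> pw (Suc n)"
    then obtain g where g: "g \<in> carrier G" "h = g [^] (p ^ Suc n)" using pwE by blast
    define x where "x = g [^] (p ^ n)"
    have xc: "x \<in> carrier G" and xp: "x [^] p = h" and xn: "x \<in> pw n"
      using g unfolding x_def by (auto simp: nat_pow_pow mult.commute intro: pwI)
    show "h \<in> multiples (p ^ Suc n) (G\<lparr>carrier := H\<rparr>)"
    proof (cases "x \<in> H")
      case True
      then obtain b where b: "b \<in> H" "x = b [^] (p ^ n)"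
        using Suc xn unfolding multiples_subgroup by blast
      then have "h = b [^] (p ^ Suc n)"
        using xp subgroup.mem_carrier [OF sub(1)] by (auto simp: nat_pow_pow mult.commute)
      then show ?thesis using b unfolding multiples_subgroup by blast
    next
      case False
      have xpH: "x [^] p \<in> H" using xp h by simp
      obtain j :: nat and u where u: "u \<in> H" "x [^] j \<otimes> u \<in> omega" "\<not> p dvd j"
        by (rule maximal_disjoint_meets_coprime
            [OF sub(1) subgroup.one_closed [OF subgroup_omega] sub(2) high_subgroup_maximal [OF H] xc False xpH])
      have uc: "u \<in> carrier G" by (rule subgroup.mem_carrier [OF sub(1) u(1)])
      have "x [^] j \<otimes> u \<in> pw n" using u(2) omega_iff by blast
      then have "u \<in> pw n"
        using subgroup_mult_cancel_left [OF subgroup_multiples uc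
            subgroup_nat_pow_closed [OF subgroup_multiples xn]] by blast
      then obtain b where b: "b \<in> H" "u = b [^] (p ^ n)"
        using Suc u(1) unfolding multiples_subgroup by blast
      have bc: "b \<in> carrier G" by (rule subgroup.mem_carrier [OF sub(1) b(1)])
      have eq: "(x [^] j \<otimes> u) [^] p = h [^] j \<otimes> b [^] (p ^ Suc n)"
        using xc uc bc b(2) xp
        by (simp add: nat_pow_distrib nat_pow_pow mult.commute flip: xp)
      have hH: "h [^] j \<in> H" "b [^] (p ^ Suc n) \<in> H"
        using h b(1) subgroup_nat_pow_closed [OF sub(1)] by blast+
      have "(x [^] j \<otimes> u) [^] p \<in> H" unfolding eq using hH by (rule subgroup.m_closed [OF sub(1)])
      moreover have "(x [^] j \<otimes> u) [^] p \<in> omega" using u(2) by (rule subgroup_nat_pow_closed [OF subgroup_omega])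
      ultimately have "h [^] j \<otimes> b [^] (p ^ Suc n) = \<one>" using eq sub(2) by auto
      then have one: "h [^] j \<otimes> b [^] (p ^ Suc n) \<in> multiples (p ^ Suc n) (G\<lparr>carrier := H\<rparr>)"
        using subgroup.one_closed [OF M] by simp
      have hc: "h \<in> carrier G" using g by simp
      have "b [^] (p ^ Suc n) \<in> multiples (p ^ Suc n) (G\<lparr>carrier := H\<rparr>)"
        using b(1) unfolding multiples_subgroup by blast
      then have "h [^] j \<in> multiples (p ^ Suc n) (G\<lparr>carrier := H\<rparr>)"
        using one by (rule subgroup_mult_cancel_right [OF M nat_pow_closed [OF hc]])
      then show ?thesis using coprime_root_closed [OF M hc _ u(3)] by blast
    qed
  qed
qed

section \<open>Filtrations of direct sums of cyclic groups and the criterion for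
  \<Sigma>-groups\<close>

lemma cyclic_bounded:
  assumes C: "subgroup C G" "cyclic_group (subgroup_generated G C)"
  obtains n where "\<And>c. c \<in> C \<Longrightarrow> c [^] (p ^ n) = \<one>"
proof -
  interpret C: group "subgroup_generated G C" by simp
  have car: "carrier (subgroup_generated G C) = C"
    by (rule subgroup.carrier_subgroup_generated_subgroup [OF C(1)])
  then obtain z where z: "z \<in> C" "C = range (\<lambda>n::int. z [^]\<^bsub>subgroup_generated G C\<^esub> n)"
    using C(2) unfolding C.cyclic_group by auto
  define q where "q = (\<lambda>n::int. z [^]\<^bsub>subgroup_generated G C\<^esub> n)"
  have Cq: "C = range q" unfolding q_def by (rule z(2))
  have zc: "z \<in> carrier G" by (rule subgroup.mem_carrier [OF C(1) z(1)])
  obtain n where n: "z [^] (p ^ n) = \<one>" using torsion zc by blast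
  have "c [^] (p ^ n) = \<one>" if "c \<in> C" for c
  proof -
    obtain i where "c = q i" using \<open>c \<in> C\<close> Cq by (metis imageE)
    then have c: "c = z [^] i" unfolding q_def using z(1) car by (simp add: int_pow_subgroup_generated)
    have "c [^] (p ^ n) = z [^] (i * int (p ^ n))"
      using zc unfolding c by (simp only: int_pow_int [symmetric] int_pow_pow)
    also have "\<dots> = (z [^] (p ^ n)) [^] i"
      using zc by (simp only: int_pow_int [symmetric] int_pow_pow mult.commute)
    finally show ?thesis using n by simp
  qed
  then show thesis using that by blast
qed

text \<open>\<open>D n\<close> is the sum of the cyclic summands killed by \<open>p ^ n\<close>. An
  element of \<open>pw n\<close> has coordinates divisible by \<open>p ^ n\<close> in their
  summands, so its coordinates in these summands vanish.\<close>

lemma direct_sum_of_cyclics_filtration: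
  assumes "direct_sum_of_cyclics G"
  obtains D where "\<And>n. subgroup (D n) G" "\<And>n::nat. D n \<subseteq> D (Suc n)" "(\<Union>n. D n) = carrier G"
    "\<And>n. D n \<inter> pw n \<subseteq> {\<one>}"
proof -
  obtain \<C> where sub: "\<And>C. C \<in> \<C> \<Longrightarrow> subgroup C G"
    and cyc: "\<And>C. C \<in> \<C> \<Longrightarrow> cyclic_group (subgroup_generated G C)"
    and iso: "(\<lambda>x. gfinprod G x \<C>) \<in> iso (sum_group \<C> (\<lambda>C. subgroup_generated G C)) G"
    using assms unfolding direct_sum_of_cyclics_def by blast
  define S where "S = sum_group \<C> (\<lambda>C. subgroup_generated G C)"
  define f where "f = (\<lambda>x. gfinprod G x \<C>)"
  interpret S: group S unfolding S_def by simp
  have car: "carrier (subgroup_generated G C) = C" if "C \<in> \<C>" for C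
    by (rule subgroup.carrier_subgroup_generated_subgroup [OF sub [OF that]])
  have Scar: "carrier S = {x \<in> \<Pi>\<^sub>E C\<in>\<C>. C. finite {C \<in> \<C>. x C \<noteq> \<one>}}"
    unfolding S_def using car by (subst carrier_sum_group) (auto cong: PiE_cong)
  have fiso: "f \<in> iso S G" using iso unfolding f_def S_def .
  then interpret f: group_hom S G f
    using S.is_group by (simp add: group_hom_def group_hom_axioms_def iso_def)
  have inj: "inj_on f (carrier S)" and surj: "f ` carrier S = carrier G"
    using fiso by (auto simp: iso_def bij_betw_def)
  \<comment> \<open>Elements of the external sum supported on the summands killed by
    \<open>p ^ n\<close>; \<open>D n\<close> is the image under \<open>f\<close>.\<close>
  define E where "E n = {x \<in> carrier S. \<forall>C\<in>\<C>. x C \<noteq> \<one> \<longrightarrow> (\<forall>c\<in>C. c [^] (p ^ n) = \<one>)}" for n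
  have one_S: "\<one>\<^bsub>S\<^esub> C = \<one>" if "C \<in> \<C>" for C using that unfolding S_def by simp
  have mult_S: "(x \<otimes>\<^bsub>S\<^esub> y) C = x C \<otimes> y C" if "C \<in> \<C>" for x y C using that unfolding S_def by simp
  have pow_S: "(x [^]\<^bsub>S\<^esub> k) C = x C [^] k" if "C \<in> \<C>" for x C and k :: nat
    using that by (induction k) (simp_all add: one_S mult_S)
  have inv_S: "(inv\<^bsub>S\<^esub> x) C = inv (x C)" if "C \<in> \<C>" "x \<in> carrier S" for x C
  proof -
    have "x C \<in> carrier (subgroup_generated G C)" using that car Scar by (auto simp: PiE_iff)
    then show ?thesis using that unfolding S_def by simp
  qed
  have Esub: "subgroup (E n) S" for n
  proof (rule S.subgroupI)
    show "E n \<noteq> {}" using S.one_closed one_S unfolding E_def by blast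
    show "inv\<^bsub>S\<^esub> a \<in> E n" if "a \<in> E n" for a
      using that inv_S inv_one unfolding E_def by (smt (verit, ccfv_SIG) mem_Collect_eq S.inv_closed)
    show "a \<otimes>\<^bsub>S\<^esub> b \<in> E n" if ab: "a \<in> E n" "b \<in> E n" for a b
    proof -
      have "a C \<noteq> \<one> \<or> b C \<noteq> \<one>" if "C \<in> \<C>" "(a \<otimes>\<^bsub>S\<^esub> b) C \<noteq> \<one>" for C
        using that mult_S by (metis l_one one_closed)
      then show ?thesis using ab unfolding E_def by blast
    qed
  qed (auto simp: E_def)
  have Emono: "E n \<subseteq> E (Suc n)" for n
  proof
    fix x assume x: "x \<in> E n"
    have "c [^] (p ^ Suc n) = \<one>" if C: "C \<in> \<C>" "x C \<noteq> \<one>" "c \<in> C" for C c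
    proof -
      have "c \<in> carrier G" "c [^] (p ^ n) = \<one>"
        using C x subgroup.mem_carrier [OF sub] unfolding E_def by auto
      then have "(c [^] (p ^ n)) [^] p = \<one>" "c \<in> carrier G" by auto
      then show ?thesis by (simp add: nat_pow_pow mult.commute)
    qed
    then show "x \<in> E (Suc n)" using x unfolding E_def by blast
  qed
  have Eun: "\<exists>n. x \<in> E n" if x: "x \<in> carrier S" for x
  proof -
    define F where "F = {C \<in> \<C>. x C \<noteq> \<one>}"
    have F: "finite F" using x unfolding F_def Scar by blast
    have "\<forall>C\<in>\<C>. \<exists>n. \<forall>c\<in>C. c [^] (p ^ n) = \<one>" using cyclic_bounded [OF sub cyc] by metis
    then obtain k where k: "\<And>C c. C \<in> \<C> \<Longrightarrow> c \<in> C \<Longrightarrow> c [^] (p ^ k C) = \<one>" by metis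
    define n where "n = (\<Sum>C\<in>F. k C)"
    have "c [^] (p ^ n) = \<one>" if C: "C \<in> \<C>" "x C \<noteq> \<one>" "c \<in> C" for C c
    proof -
      have "k C \<le> n" unfolding n_def using C F member_le_sum [of C F k] by (simp add: F_def)
      then have "p ^ n = p ^ k C * p ^ (n - k C)" by (simp flip: power_add)
      moreover have "c \<in> carrier G" using C subgroup.mem_carrier [OF sub] by blast
      ultimately have "c [^] (p ^ n) = (c [^] (p ^ k C)) [^] (p ^ (n - k C))" by (simp add: nat_pow_pow)
      then show ?thesis using k C by simp
    qed
    then show ?thesis using x unfolding E_def by blast
  qed
  have bound: "f ` E n \<inter> pw n \<subseteq> {\<one>}" for n
  proof
    fix g assume g: "g \<in> f ` E n \<inter> pw n"
    then obtain x where x: "x \<in> E n" "g = f x" by blast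
    obtain g' where g': "g' \<in> carrier G" "g = g' [^] (p ^ n)" using g pwE by blast
    obtain y where y: "y \<in> carrier S" "g' = f y" using g'(1) surj by blast
    have "f x = f (y [^]\<^bsub>S\<^esub> (p ^ n))" using x(2) g'(2) y by (simp add: f.hom_nat_pow)
    then have xy: "x = y [^]\<^bsub>S\<^esub> (p ^ n)"
      using inj x(1) y(1) unfolding E_def by (auto dest: inj_onD)
    have xS: "x \<in> carrier S" using x(1) unfolding E_def by blast
    have "x C = \<one>" if C: "C \<in> \<C>" for C
    proof (rule ccontr)
      assume "x C \<noteq> \<one>"
      moreover have "y C \<in> C" using y(1) C unfolding Scar by (auto simp: PiE_iff)
      ultimately have "y C [^] (p ^ n) = \<one>" using x(1) C unfolding E_def by blast
      then show False using \<open>x C \<noteq> \<one>\<close> pow_S [OF C] xy by simp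
    qed
    moreover have "x \<in> extensional \<C>" using xS unfolding Scar by (auto simp: PiE_def)
    ultimately have "x = \<one>\<^bsub>S\<^esub>" unfolding S_def by (auto simp: extensional_def)
    then show "g \<in> {\<one>}" using x(2) by simp
  qed
  show thesis
  proof (rule that [of "\<lambda>n. f ` E n"])
    show "subgroup (f ` E n) G" for n by (rule f.subgroup_img_is_subgroup [OF Esub])
    show "f ` E n \<subseteq> f ` E (Suc n)" for n using Emono by blast
    have "E n \<subseteq> carrier S" for n unfolding E_def by (rule Collect_restrict)
    moreover have "carrier S \<subseteq> (\<Union>n. E n)" using Eun by (simp add: subset_iff)
    ultimately have "(\<Union>n. E n) = carrier S" by (intro subset_antisym UN_least)
    then show "(\<Union>n. f ` E n) = carrier G" using surj by (simp flip: image_UN)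
    show "f ` E n \<inter> pw n \<subseteq> {\<one>}" for n by (rule bound)
  qed
qed

text \<open>From left to right, the filtration of a high direct sum of cyclics is enlarged by
  \<open>omega\<close> and cut down to the socle. From right to left, an arbitrary high subgroup
  \<open>H\<close> is taken: since \<open>H\<close> meets \<open>omega\<close> trivially, the sets
  \<open>P n \<inter> H\<close> satisfy the hypotheses of \<open>kulikov\<close>.\<close>

lemma sigma_group_iff:
  "sigma_group p G \<longleftrightarrow>
     (\<exists>P. (\<forall>n. subgroup (P n) G) \<and> (\<forall>n::nat. P n \<subseteq> P (Suc n)) \<and> (\<Union>n. P n) = socle \<and>
          (\<forall>n. \<exists>m. P n \<inter> pw m \<subseteq> omega))" (is "?L \<longleftrightarrow> ?R")
proof
  assume ?L
  then obtain H where H: "high_subgroup p H G" "direct_sum_of_cyclics (G\<lparr>carrier := H\<rparr>)"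
    unfolding sigma_group_def by blast
  have sub: "subgroup H G" using H unfolding high_subgroup_def by auto
  interpret H: primary_group "G\<lparr>carrier := H\<rparr>" p by (rule primary_subgroup [OF sub])
  obtain D where D: "\<And>n. subgroup (D n) (G\<lparr>carrier := H\<rparr>)" "\<And>n::nat. D n \<subseteq> D (Suc n)"
    "(\<Union>n. D n) = carrier (G\<lparr>carrier := H\<rparr>)" "\<And>n. D n \<inter> H.pw n \<subseteq> {\<one>\<^bsub>G\<lparr>carrier := H\<rparr>\<^esub>}"
    using H.direct_sum_of_cyclics_filtration [OF H(2)] by blast
  have DG: "subgroup (D n) G" for n by (rule incl_subgroup [OF sub D(1)])
  define P where "P n = socle \<inter> (D n <#> omega)" for n
  have P1: "subgroup (P n) G" for n
    unfolding P_def
    by (intro subgroups_Inter_pair subgroup_socle mult_subgroups [OF DG subgroup_omega])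
  have P2: "P n \<subseteq> P (Suc n)" for n
    unfolding P_def using D(2) [of n] by (auto simp: set_mult_def)
  have P3: "socle \<subseteq> (\<Union>n. P n)"
  proof
    fix x assume x: "x \<in> socle"
    then obtain h w where hw: "h \<in> H" "w \<in> omega" "x = h \<otimes> w"
      using high_subgroup_socle [OF H(1)] unfolding set_mult_def by blast
    moreover obtain n where "h \<in> D n" using hw(1) D(3) by auto
    ultimately have "x \<in> P n" using x unfolding P_def set_mult_def by blast
    then show "x \<in> (\<Union>n. P n)" by blast
  qed
  \<comment> \<open>Modulo \<open>omega\<close> the element is some \<open>d\<close> in
    \<open>D n\<close> of height at least \<open>n\<close> in \<open>G\<close>. Purity of
    \<open>H\<close> makes \<open>d\<close> divisible by \<open>p ^ n\<close> inside
    \<open>H\<close>, and there \<open>D n\<close> contains no such element except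
    \<open>\<one>\<close>.\<close>
  have P4: "P n \<inter> pw n \<subseteq> omega" for n
  proof
    fix z assume z: "z \<in> P n \<inter> pw n"
    then obtain d w where d: "d \<in> D n" "w \<in> omega" "z = d \<otimes> w" unfolding P_def set_mult_def by blast
    have dc: "d \<in> carrier G" by (rule subgroup.mem_carrier [OF DG d(1)])
    have "d \<in> pw n"
      using subgroup_mult_cancel_right [OF subgroup_multiples dc, of w] d z by (simp add: omega_iff)
    moreover have "d \<in> H" using d(1) D(3) by auto
    ultimately have "d \<in> H.pw n" using high_subgroup_pure [OF H(1)] by blast
    then have "d = \<one>" using D(4) d(1) by auto
    then show "z \<in> omega" using d subgroup.mem_carrier [OF subgroup_omega] by simp
  qed
  have "(\<Union>n. P n) = socle" using P3 unfolding P_def by blast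
  then show ?R using P1 P2 P4 by (intro exI [of _ P] conjI allI) (assumption | rule exI)+
next
  assume ?R
  then obtain P where P': "(\<forall>n. subgroup (P n) G) \<and> (\<forall>n::nat. P n \<subseteq> P (Suc n)) \<and> (\<Union>n. P n) = socle \<and>
      (\<forall>n. \<exists>m. P n \<inter> pw m \<subseteq> omega)" by (rule exE)
  then have P: "\<And>n. subgroup (P n) G" "\<And>n::nat. P n \<subseteq> P (Suc n)" "(\<Union>n. P n) = socle"
    "\<And>n. \<exists>m. P n \<inter> pw m \<subseteq> omega" by simp_all
  obtain H where H: "high_subgroup p H G" by (rule high_subgroup_exists)
  have sub: "subgroup H G" "H \<inter> omega = {\<one>}" using H unfolding high_subgroup_def by auto
  interpret H: primary_group "G\<lparr>carrier := H\<rparr>" p by (rule primary_subgroup [OF sub(1)])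
  have "direct_sum_of_cyclics (G\<lparr>carrier := H\<rparr>)"
  proof (rule H.kulikov [where S = "\<lambda>n. P n \<inter> H"])
    show "subgroup (P n \<inter> H) (G\<lparr>carrier := H\<rparr>)" for n
      by (rule subgroup_incl [OF subgroups_Inter_pair [OF P(1) sub(1)] sub(1)]) simp
    show "P n \<inter> H \<subseteq> P (Suc n) \<inter> H" for n using P(2) by blast
    show "(\<Union>n. P n \<inter> H) = H.socle" using P(3) subgroup_socle_restrict [OF sub(1)] by blast
    show "\<exists>m. P n \<inter> H \<inter> H.pw m \<subseteq> {\<one>\<^bsub>G\<lparr>carrier := H\<rparr>\<^esub>}" for n
    proof -
      obtain m where "P n \<inter> pw m \<subseteq> omega" using P(4) by blast
      then have "P n \<inter> H \<inter> H.pw m \<subseteq> {\<one>}"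
        using multiples_subgroup_subset [OF subgroup.subset [OF sub(1)]] sub(2) by blast
      then show ?thesis by auto
    qed
  qed
  then show ?L using H abelian_p_group unfolding sigma_group_def by blast
qed

end

section \<open>Cyclic summands\<close>

context primary_group
begin

text \<open>The endomorphism sends \<open>y\<close> to \<open>z\<close> and kills \<open>M\<close>.
  The hypothesis \<open>ind\<close> is exactly what makes it independent of the representation y^j
  u.\<close>

lemma complement_hom:
  assumes M: "subgroup M G" and y: "y \<in> carrier G" and z: "z \<in> carrier G"
    and gen: "\<And>g. g \<in> carrier G \<Longrightarrow> \<exists>j::nat. \<exists>u\<in>M. g = y [^] j \<otimes> u"
    and ind: "\<And>i::nat. y [^] i \<in> M \<Longrightarrow> z [^] i = \<one>"
  obtains f where "f \<in> hom G G" "\<And>(j::nat) u. u \<in> M \<Longrightarrow> f (y [^] j \<otimes> u) = z [^] j"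
proof -
  \<comment> \<open>Exponents are natural numbers, so two representations are compared first under
    \<open>i \<le> j\<close>, where the difference is again an exponent.\<close>
  have le: "z [^] j = z [^] i"
    if uv: "u \<in> M" "v \<in> M" and eq: "y [^] i \<otimes> u = y [^] j \<otimes> v" and "i \<le> j" for i j :: nat and u v
  proof -
    define d where "d = j - i"
    have j: "j = i + d" using \<open>i \<le> j\<close> unfolding d_def by simp
    have c: "u \<in> carrier G" "v \<in> carrier G" using uv subgroup.mem_carrier [OF M] by auto
    have "y [^] i \<otimes> u = y [^] i \<otimes> (y [^] d \<otimes> v)"
      using eq y c unfolding j by (simp add: m_assoc flip: nat_pow_mult)
    then have "u = y [^] d \<otimes> v" using y c by simp
    then have "y [^] d \<in> M"
      using subgroup_mult_cancel_right [OF M nat_pow_closed [OF y] uv(2)] uv(1) by simp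
    then show ?thesis using ind [of d] z unfolding j by (simp flip: nat_pow_mult)
  qed
  have wd: "z [^] i = z [^] j"
    if uv: "u \<in> M" "v \<in> M" "y [^] i \<otimes> u = y [^] j \<otimes> v" for i j :: nat and u v
    using le [OF uv] le [OF uv(2,1) uv(3) [symmetric]] by (metis nat_le_linear)
  define e where "e g = (SOME j::nat. \<exists>u\<in>M. g = y [^] j \<otimes> u)" for g
  have e: "\<exists>u\<in>M. g = y [^] e g \<otimes> u" if "g \<in> carrier G" for g
    unfolding e_def by (rule someI_ex [OF gen [OF that]])
  define f where "f g = z [^] e g" for g
  have f: "f (y [^] j \<otimes> u) = z [^] j" if u: "u \<in> M" for j :: nat and u
  proof -
    have "y [^] j \<otimes> u \<in> carrier G" using y u subgroup.mem_carrier [OF M] by simp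
    then obtain v where "v \<in> M" "y [^] j \<otimes> u = y [^] e (y [^] j \<otimes> u) \<otimes> v" using e by blast
    then show ?thesis unfolding f_def using wd [OF _ u] by metis
  qed
  have "f \<in> hom G G"
  proof (rule homI)
    show "f g \<in> carrier G" for g unfolding f_def using z by simp
    fix g g' assume g: "g \<in> carrier G" "g' \<in> carrier G"
    obtain i j :: nat and u v where u: "u \<in> M" "g = y [^] i \<otimes> u" and v: "v \<in> M" "g' = y [^] j \<otimes> v"
      using gen g by meson
    have c: "u \<in> carrier G" "v \<in> carrier G" using u v subgroup.mem_carrier [OF M] by auto
    have "g \<otimes> g' = y [^] (i + j) \<otimes> (u \<otimes> v)"
      using u v c y by (simp add: m_ac flip: nat_pow_mult)
    moreover have "u \<otimes> v \<in> M" using u v subgroup.m_closed [OF M] by blast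
    ultimately have "f (g \<otimes> g') = z [^] (i + j)" using f by simp
    then show "f (g \<otimes> g') = f g \<otimes> f g'" using f u v z by (simp add: nat_pow_mult)
  qed
  then show thesis using that f by blast
qed

text \<open>The order of \<open>y\<close> is a power of \<open>p\<close> divisible by
  \<open>p ^ Suc m\<close>; hence so is \<open>i\<close>, which therefore kills
  \<open>z\<close>.\<close>

lemma pow_eq_one_transfer:
  assumes y: "y \<in> carrier G" "y [^] (p ^ m) \<noteq> \<one>" "y [^] (i::nat) = \<one>"
    and z: "z \<in> carrier G" "z [^] (p ^ Suc m) = \<one>"
  shows "z [^] i = \<one>"
proof (cases "i = 0")
  case False
  have "\<not> is_unit p" using prime_p by (metis not_prime_unit)
  then obtain c where c: "i = p ^ multiplicity p i * c" "\<not> p dvd c"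
    using multiplicity_decompose' [OF False] by blast
  define v where "v = multiplicity p i"
  have i: "i = p ^ v * c" using c(1) unfolding v_def .
  have "(y [^] (p ^ v)) [^] c \<in> {\<one>}" using y(1,3) by (simp add: nat_pow_pow flip: i)
  then have yv: "y [^] (p ^ v) = \<one>"
    using coprime_root_closed [OF triv_subgroup _ _ c(2)] y(1) by blast
  have "\<not> v \<le> m"
  proof
    assume "v \<le> m"
    then have "p ^ m = p ^ v * p ^ (m - v)" by (simp flip: power_add)
    then have "y [^] (p ^ m) = (y [^] (p ^ v)) [^] (p ^ (m - v))" using y(1) by (simp add: nat_pow_pow)
    then show False using yv y(2) by simp
  qed
  then have "p ^ v = p ^ Suc m * p ^ (v - Suc m)" by (simp only: power_add [symmetric]) simp
  then have "z [^] i = (z [^] (p ^ Suc m)) [^] (p ^ (v - Suc m) * c)"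
    using z(1) i by (simp add: nat_pow_pow mult.assoc)
  then show ?thesis using z(2) by simp
qed simp

text \<open>A subgroup containing \<open>pw (Suc m)\<close> and maximal among those that meet the cyclic group of \<open>y\<close>
  trivially is a complement of that group.\<close>

lemma pure_cyclic_complement:
  assumes y: "y \<in> carrier G" "y [^] (p ^ m) \<notin> pw (Suc m)" "y [^] (p ^ Suc m) = \<one>"
  obtains M where "subgroup M G" "pw (Suc m) \<subseteq> M"
    "\<And>g. g \<in> carrier G \<Longrightarrow> \<exists>j::nat. \<exists>u\<in>M. g = y [^] j \<otimes> u"
    "\<And>i::nat. y [^] i \<in> M \<Longrightarrow> y [^] i = \<one>"
proof -
  define C where "C = generate G {y}"
  have C: "subgroup C G" unfolding C_def using y by (intro generate_is_subgroup) simp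
  have yC: "y [^] i \<in> C" for i :: nat
    by (rule subgroup_nat_pow_closed [OF C]) (simp add: C_def generate.incl)
  have Cy: "\<exists>i::nat. c = y [^] i" if c: "c \<in> C" for c
  proof -
    obtain i :: nat and u where "u \<in> generate G {}" "c = y [^] i \<otimes> u"
      using generate_insertE [OF y(1) empty_subsetI] c unfolding C_def by blast
    then show ?thesis using y(1) by (auto simp: generate_empty)
  qed
  have x1: "y [^] (p ^ m) \<noteq> \<one>" using y(2) subgroup.one_closed [OF subgroup_multiples] by metis
  \<comment> \<open>Tested on the socle: the socle elements of \<open>C\<close> are multiples of
    \<open>y [^] (p ^ m)\<close>, and such a multiple with coefficient prime to \<open>p\<close>
    would bring \<open>y [^] (p ^ m)\<close> into \<open>pw (Suc m)\<close>.\<close>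
  have "pw (Suc m) \<inter> C = {\<one>}"
  proof (rule trivial_socle)
    show "subgroup (pw (Suc m) \<inter> C) G" by (rule subgroups_Inter_pair [OF subgroup_multiples C])
    show "pw (Suc m) \<inter> C \<inter> socle \<subseteq> {\<one>}"
    proof
      fix s assume s: "s \<in> pw (Suc m) \<inter> C \<inter> socle"
      then obtain i :: nat where i: "s = y [^] i" using Cy by blast
      then have "y [^] i \<in> socle" using s by simp
      then obtain c :: nat where c: "y [^] i = (y [^] (p ^ m)) [^] c" by (rule socle_of_cyclic [OF y(1) x1])
      have "p dvd c"
      proof (rule ccontr)
        assume nc: "\<not> p dvd c"
        have "(y [^] (p ^ m)) [^] c \<in> pw (Suc m)" using s i c by simp
        then have "y [^] (p ^ m) \<in> pw (Suc m)"
          by (rule coprime_root_closed [OF subgroup_multiples nat_pow_closed [OF y(1)] _ nc])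
        then show False using y(2) by blast
      qed
      moreover have "y [^] (p ^ m) \<in> socle" using y by (simp add: socle_def nat_pow_pow mult.commute)
      ultimately show "s \<in> {\<one>}" using i c by (simp add: socle_pow_dvd)
    qed
  qed
  then obtain M where M: "subgroup M G" "pw (Suc m) \<subseteq> M" "M \<inter> C = {\<one>}"
    and max: "\<forall>K. subgroup K G \<longrightarrow> K \<inter> C = {\<one>} \<longrightarrow> M \<subseteq> K \<longrightarrow> K = M"
    by (rule maximal_disjoint_subgroup [OF subgroup_multiples])
  have max': "K = M" if "subgroup K G" "K \<inter> C = {\<one>}" "M \<subseteq> K" for K using max that by blast
  define T where "T = C <#> M"
  have T: "subgroup T G" unfolding T_def by (rule mult_subgroups [OF C M(1)])
  have TI: "c \<otimes> u \<in> T" if "c \<in> C" "u \<in> M" for c u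
    using that unfolding T_def set_mult_def by blast
  have MT: "u \<in> T" if "u \<in> M" for u
    using TI [OF subgroup.one_closed [OF C] that] subgroup.mem_carrier [OF M(1) that] by simp
  have CT: "c \<in> T" if "c \<in> C" for c
    using TI [OF that subgroup.one_closed [OF M(1)]] subgroup.mem_carrier [OF C that] by simp
  \<comment> \<open>Write p g = c y + u0 with u0 in \<open>M\<close>. Since p^(m+1) g lies in
    \<open>M\<close>, p^m c y lies in both \<open>M\<close> and \<open>C\<close> and vanishes, so
    \<open>p\<close> divides \<open>c\<close>. Subtracting (c/p) y from \<open>g\<close> gives
    \<open>g'\<close> with p g' in \<open>M\<close>, to which maximality of \<open>M\<close>
    applies.\<close>
  have step: "g \<in> T" if g: "g \<in> carrier G" and gp: "g [^] p \<in> T" for g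
  proof -
    obtain c0 u0 where "c0 \<in> C" and u0: "u0 \<in> M" and gp0: "g [^] p = c0 \<otimes> u0"
      using gp unfolding T_def set_mult_def by blast
    then obtain c :: nat where c: "g [^] p = y [^] c \<otimes> u0" using Cy by blast
    have u0c: "u0 \<in> carrier G" by (rule subgroup.mem_carrier [OF M(1) u0])
    have "g [^] (p ^ Suc m) = (g [^] p) [^] (p ^ m)" using g by (simp add: nat_pow_pow)
    also have "\<dots> = y [^] (c * p ^ m) \<otimes> u0 [^] (p ^ m)"
      using c y(1) u0c by (simp add: nat_pow_distrib nat_pow_pow)
    finally have "y [^] (c * p ^ m) \<otimes> u0 [^] (p ^ m) \<in> M" using pwI [OF g] M(2) by (metis subsetD)
    then have "y [^] (c * p ^ m) \<in> M"
      by (rule subgroup_mult_cancel_right [OF M(1) nat_pow_closed [OF y(1)] subgroup_nat_pow_closed [OF M(1) u0]])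
    then have one: "y [^] (c * p ^ m) = \<one>" using yC M(3) by blast
    have "p dvd c"
    proof (rule ccontr)
      assume nc: "\<not> p dvd c"
      have "(y [^] (p ^ m)) [^] c \<in> {\<one>}" using one y(1) by (simp add: nat_pow_pow mult.commute)
      then have "y [^] (p ^ m) \<in> {\<one>}"
        by (rule coprime_root_closed [OF triv_subgroup nat_pow_closed [OF y(1)] _ nc])
      then show False using x1 by blast
    qed
    then obtain d where d: "c = p * d" by blast
    define g' where "g' = g \<otimes> inv (y [^] d)"
    have g'c: "g' \<in> carrier G" unfolding g'_def using g y(1) by simp
    have "g' [^] p = g [^] p \<otimes> inv (y [^] c)"
      unfolding g'_def d using g y(1) by (simp add: nat_pow_distrib nat_pow_inv nat_pow_pow mult.commute)
    also have "\<dots> = u0" unfolding c using y(1) u0c by (simp add: m_ac)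
    finally have g'p: "g' [^] p \<in> M" using u0 by simp
    have "g' \<in> T"
    proof (cases "g' \<in> M")
      case True
      then show ?thesis by (rule MT)
    next
      case False
      obtain j :: nat and u where u: "u \<in> M" "g' [^] j \<otimes> u \<in> C" and nj: "\<not> p dvd j"
        by (rule maximal_disjoint_meets_coprime
            [OF M(1) subgroup.one_closed [OF C] M(3) max' g'c False g'p])
      have "g' [^] j \<in> T"
        by (rule subgroup_mult_cancel_right [OF T nat_pow_closed [OF g'c] MT [OF u(1)] CT [OF u(2)]])
      then show ?thesis by (rule coprime_root_closed [OF T g'c _ nj])
    qed
    then show ?thesis unfolding g'_def
      by (rule subgroup_mult_cancel_right [OF T g subgroup.m_inv_closed [OF T CT [OF yC]]])
  qed
  have all: "g \<in> T" if "g \<in> carrier G" "g [^] (p ^ k) = \<one>" for g k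
    using that
  proof (induction k arbitrary: g)
    case 0
    then show ?case using subgroup.one_closed [OF T] by simp
  next
    case (Suc k)
    then have "g [^] p \<in> T" by (simp add: nat_pow_pow)
    then show ?case using step Suc.prems(1) by blast
  qed
  have "\<exists>j::nat. \<exists>u\<in>M. g = y [^] j \<otimes> u" if g: "g \<in> carrier G" for g
  proof -
    have "g \<in> T" using all torsion g by blast
    then obtain c u where "c \<in> C" "u \<in> M" "g = c \<otimes> u" unfolding T_def set_mult_def by blast
    then show ?thesis using Cy by blast
  qed
  moreover have "y [^] i = \<one>" if "y [^] i \<in> M" for i :: nat using that yC M(3) by blast
  ultimately show thesis using that M(1,2) by blast
qed

text \<open>Let \<open>d\<close> be the last of the multiples p^i g outside \<open>omega\<close>,
  and let \<open>m\<close> be its exact height, d = p^m a. Since p d has infinite height,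
  \<open>a\<close> can be corrected by a multiple of \<open>p\<close> to an element \<open>y\<close>
  of order p^(m+1) for which p^m y still has height \<open>m\<close>.\<close>

lemma not_omega_pure_cyclic:
  assumes g: "g \<in> carrier G" "g \<notin> omega"
  obtains j m y v where "y \<in> carrier G" "y [^] (p ^ m) \<notin> pw (Suc m)" "y [^] (p ^ Suc m) = \<one>"
    "v \<in> pw (Suc m)" "g [^] (p ^ j) = y [^] (p ^ m) \<otimes> v"
proof -
  obtain n where n: "g [^] (p ^ n) = \<one>" using torsion g(1) by blast
  define i where "i = (LEAST i. g [^] (p ^ i) \<in> omega)"
  have "g [^] (p ^ n) \<in> omega" using n subgroup.one_closed [OF subgroup_omega] by simp
  then have i: "g [^] (p ^ i) \<in> omega" unfolding i_def by (rule LeastI)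
  have "i \<noteq> 0" using i g by (metis nat_pow_eone power_0)
  then obtain j where j: "i = Suc j" using not0_implies_Suc by blast
  define d where "d = g [^] (p ^ j)"
  have dn: "d \<notin> omega"
    using not_less_Least [of j "\<lambda>i. g [^] (p ^ i) \<in> omega"] j unfolding d_def i_def by auto
  have dc: "d \<in> carrier G" unfolding d_def using g(1) by simp
  have dp: "d [^] p \<in> omega" using i j g(1) unfolding d_def by (simp add: nat_pow_pow mult.commute)
  obtain n where n: "d \<notin> pw n" using dn by (auto simp: omega_iff)
  define k where "k = (LEAST n. d \<notin> pw n)"
  have k: "d \<notin> pw k" unfolding k_def by (rule LeastI) (rule n)
  then have "k \<noteq> 0" using dc by (metis pw_0)
  then obtain m where m: "k = Suc m" using not0_implies_Suc by blast
  then have "d \<in> pw m" using not_less_Least [of m "\<lambda>n. d \<notin> pw n"] unfolding k_def by auto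
  then obtain a where a: "a \<in> carrier G" "d = a [^] (p ^ m)" by (rule pwE)
  \<comment> \<open>The exponent m + 2 is chosen so that, after one factor \<open>p\<close> is
    removed, \<open>v\<close> still lies in \<open>pw (Suc m)\<close>; changing \<open>d\<close> by
    \<open>v\<close> then does not raise its height.\<close>
  have "d [^] p \<in> pw (Suc (Suc m))" using dp omega_iff by blast
  then obtain u where u: "u \<in> carrier G" "d [^] p = u [^] (p ^ Suc (Suc m))" by (rule pwE)
  define v where "v = u [^] (p ^ Suc m)"
  have v: "v \<in> pw (Suc m)" "v \<in> carrier G"
    unfolding v_def using u(1) by (rule pwI, rule nat_pow_closed)
  define y where "y = a \<otimes> inv (u [^] p)"
  have yc: "y \<in> carrier G" unfolding y_def using a u by simp
  have ym: "y [^] (p ^ m) = d \<otimes> inv v"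
    unfolding y_def v_def using a u by (simp add: nat_pow_distrib nat_pow_inv nat_pow_pow)
  have "y [^] (p ^ Suc m) = (d \<otimes> inv v) [^] p"
    using yc by (simp add: nat_pow_pow mult.commute flip: ym)
  also have "\<dots> = d [^] p \<otimes> inv (v [^] p)" using dc v by (simp add: nat_pow_distrib nat_pow_inv)
  also have "v [^] p = d [^] p" unfolding v_def u(2) using u(1) by (simp add: nat_pow_pow ac_simps)
  finally have "y [^] (p ^ Suc m) = \<one>" using dc by simp
  moreover have "y [^] (p ^ m) \<notin> pw (Suc m)"
  proof
    assume "y [^] (p ^ m) \<in> pw (Suc m)"
    then have "d \<in> pw (Suc m)"
      unfolding ym
      by (rule subgroup_mult_cancel_right [OF subgroup_multiples dc
            subgroup.m_inv_closed [OF subgroup_multiples v(1)]])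
    then show False using k m by blast
  qed
  moreover have "g [^] (p ^ j) = y [^] (p ^ m) \<otimes> v"
    unfolding ym d_def [symmetric] using dc v by (simp add: m_assoc)
  ultimately show thesis using that yc v by blast
qed

text \<open>If p^k l is outside \<open>omega\<close>, a cyclic summand generated by \<open>y\<close>
  of order p^(m+1) detects it. \<open>L\<close> then contains p^N y for N = m + 1 - k. Any
  \<open>x\<close> = p^N w with p^k x = 0 has p^(m+1) w = 0, so an endomorphism carries
  \<open>y\<close> to \<open>w\<close> and p^N y to \<open>x\<close>.\<close>

lemma fully_invariant_dichotomy:
  assumes L: "fully_invariant L G"
  shows "(\<exists>N. \<forall>x\<in>pw N. x [^] (p ^ k) = \<one> \<longrightarrow> x \<in> L) \<or> (\<forall>l\<in>L. l [^] (p ^ k) \<in> omega)"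
proof (rule disjCI)
  have sub: "subgroup L G" using L unfolding fully_invariant_def by blast
  have inv: "f l \<in> L" if "f \<in> hom G G" "l \<in> L" for f l
    using L that unfolding fully_invariant_def by blast
  assume "\<not> (\<forall>l\<in>L. l [^] (p ^ k) \<in> omega)"
  then obtain l where l: "l \<in> L" "l [^] (p ^ k) \<notin> omega" by blast
  have lc: "l \<in> carrier G" by (rule subgroup.mem_carrier [OF sub l(1)])
  obtain j m y v where y: "y \<in> carrier G" "y [^] (p ^ m) \<notin> pw (Suc m)" "y [^] (p ^ Suc m) = \<one>"
    and v: "v \<in> pw (Suc m)" "(l [^] (p ^ k)) [^] (p ^ j) = y [^] (p ^ m) \<otimes> v"
    by (rule not_omega_pure_cyclic [OF nat_pow_closed [OF lc] l(2)])
  have y1: "y [^] (p ^ m) \<noteq> \<one>" using y(2) subgroup.one_closed [OF subgroup_multiples] by metis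
  obtain M where M: "subgroup M G" "pw (Suc m) \<subseteq> M"
    and gen: "\<And>g. g \<in> carrier G \<Longrightarrow> \<exists>j::nat. \<exists>u\<in>M. g = y [^] j \<otimes> u"
    and ind: "\<And>i::nat. y [^] i \<in> M \<Longrightarrow> y [^] i = \<one>"
    using pure_cyclic_complement [OF y] by blast
  obtain f where f: "f \<in> hom G G" "\<And>(j::nat) u. u \<in> M \<Longrightarrow> f (y [^] j \<otimes> u) = y [^] j"
    using complement_hom [OF M(1) y(1) y(1) gen ind] by blast
  obtain c :: nat and u where c: "u \<in> M" "l = y [^] c \<otimes> u" using gen [OF lc] by blast
  have fl: "f l = y [^] c" using f(2) c by simp
  then have ycL: "y [^] c \<in> L" using inv [OF f(1) l(1)] by simp
  \<comment> \<open>The projection \<open>f\<close> kills \<open>v\<close>, because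
    \<open>pw (Suc m)\<close> lies in \<open>M\<close>. Comparing its value at p^(k+j) l with
    \<open>f l\<close> = c y bounds the power of \<open>p\<close> in \<open>c\<close>.\<close>
  have "y [^] (p ^ m) = f ((l [^] (p ^ k)) [^] (p ^ j))" using f(2) v M(2) by auto
  also have "\<dots> = (f l [^] (p ^ k)) [^] (p ^ j)"
    using lc hom_nat_pow [OF f(1) _ is_group is_group] by simp
  also have "\<dots> = y [^] (c * p ^ (k + j))" unfolding fl using y(1) by (simp add: nat_pow_pow power_add ac_simps)
  finally have eq: "y [^] (c * p ^ (k + j)) = y [^] (p ^ m)" by simp
  have c0: "c \<noteq> 0" using eq y1 by (metis mult_0 nat_pow_0)
  have "\<not> is_unit p" using prime_p by (metis not_prime_unit)
  then obtain c' where c': "c = p ^ multiplicity p c * c'" "\<not> p dvd c'"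
    using multiplicity_decompose' [OF c0] by blast
  define r where "r = multiplicity p c"
  have cr: "c = p ^ r * c'" using c'(1) unfolding r_def .
  have "(y [^] (p ^ r)) [^] c' \<in> L" using ycL y(1) by (simp add: nat_pow_pow flip: cr)
  then have yrL: "y [^] (p ^ r) \<in> L" by (rule coprime_root_closed [OF sub nat_pow_closed [OF y(1)] _ c'(2)])
  \<comment> \<open>Otherwise p^(m+1) would divide the coefficient c p^(k+j), and p^m y would
    vanish.\<close>
  have rk: "r + k \<le> m"
  proof (rule ccontr)
    assume "\<not> r + k \<le> m"
    then have "r + k = Suc m + (r + k - Suc m)" by simp
    then have "p ^ (r + k) = p ^ Suc m * p ^ (r + k - Suc m)" by (metis power_add)
    then have "c * p ^ (k + j) = p ^ Suc m * (p ^ (r + k - Suc m) * c' * p ^ j)"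
      unfolding cr power_add by (metis mult.assoc mult.commute power_add)
    then have "y [^] (c * p ^ (k + j)) = (y [^] (p ^ Suc m)) [^] (p ^ (r + k - Suc m) * c' * p ^ j)"
      using y(1) by (simp only: nat_pow_pow)
    then have "y [^] (c * p ^ (k + j)) = \<one>" using y(3) by simp
    then show False using eq y1 by simp
  qed
  define N where "N = Suc m - k"
  have "p ^ N = p ^ r * p ^ (N - r)" unfolding N_def using rk by (simp flip: power_add)
  then have "y [^] (p ^ N) = (y [^] (p ^ r)) [^] (p ^ (N - r))" using y(1) by (simp add: nat_pow_pow)
  then have yNL: "y [^] (p ^ N) \<in> L" using subgroup_nat_pow_closed [OF sub yrL] by simp
  have "x \<in> L" if x: "x \<in> pw N" "x [^] (p ^ k) = \<one>" for x
  proof -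
    obtain w where w: "w \<in> carrier G" "x = w [^] (p ^ N)" using pwE [OF x(1)] by blast
    have "Suc m = N + k" unfolding N_def using rk by simp
    then have "w [^] (p ^ Suc m) = \<one>" using w x(2) by (simp only: power_add) (simp add: nat_pow_pow)
    then have "w [^] i = \<one>" if "y [^] i \<in> M" for i :: nat
      using pow_eq_one_transfer [OF y(1) y1 ind [OF that] w(1)] by blast
    then obtain f' where f': "f' \<in> hom G G" "\<And>(j::nat) u. u \<in> M \<Longrightarrow> f' (y [^] j \<otimes> u) = w [^] j"
      using complement_hom [OF M(1) y(1) w(1) gen] by blast
    have "f' (y [^] (p ^ N)) = x"
      using f'(2) [OF subgroup.one_closed [OF M(1)], of "p ^ N"] y(1) w(2) by simp
    then show ?thesis using inv [OF f'(1) yNL] by simp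
  qed
  then show "\<exists>N. \<forall>x\<in>pw N. x [^] (p ^ k) = \<one> \<longrightarrow> x \<in> L" by blast
qed

end

section \<open>Large subgroups\<close>

context primary_group
begin

text \<open>Multiplication by the part of \<open>n\<close> prime to \<open>p\<close> is bijective on
  every subgroup. Purity and divisibility, which are stated for all integers, thereby reduce to
  powers of \<open>p\<close>.\<close>

lemma multiples_prime_power_decompose:
  assumes "n > 0"
  obtains v c where "n = p ^ v * c" "\<And>K. subgroup K G \<Longrightarrow> multiples n (G\<lparr>carrier := K\<rparr>) = multiples (p ^ v) (G\<lparr>carrier := K\<rparr>)"
proof -
  have "\<not> is_unit p" using prime_p by (metis not_prime_unit)
  then obtain c where c: "n = p ^ multiplicity p n * c" "\<not> p dvd c"
    using multiplicity_decompose' [of n p] assms by blast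
  define v where "v = multiplicity p n"
  have n: "n = p ^ v * c" using c(1) unfolding v_def .
  have "multiples n (G\<lparr>carrier := K\<rparr>) = multiples (p ^ v) (G\<lparr>carrier := K\<rparr>)" if K: "subgroup K G" for K
  proof (intro subset_antisym subsetI)
    fix x assume "x \<in> multiples n (G\<lparr>carrier := K\<rparr>)"
    then obtain k where k: "k \<in> K" "x = k [^] n" unfolding multiples_subgroup by blast
    have "x = (k [^] c) [^] (p ^ v)"
      using k subgroup.mem_carrier [OF K] n by (simp add: nat_pow_pow mult.commute)
    then show "x \<in> multiples (p ^ v) (G\<lparr>carrier := K\<rparr>)"
      unfolding multiples_subgroup using subgroup_nat_pow_closed [OF K k(1)] by blast
  next
    fix x assume "x \<in> multiples (p ^ v) (G\<lparr>carrier := K\<rparr>)"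
    then obtain k where k: "k \<in> K" "x = k [^] (p ^ v)" unfolding multiples_subgroup by blast
    have kc: "k \<in> carrier G" by (rule subgroup.mem_carrier [OF K k(1)])
    obtain j :: nat where j: "(k [^] c) [^] j = k" by (rule coprime_power_inverse [OF kc c(2)])
    have "(k [^] j) [^] n = ((k [^] c) [^] j) [^] (p ^ v)" using kc n by (simp add: nat_pow_pow ac_simps)
    then have "x = (k [^] j) [^] n" using j k(2) by simp
    then show "x \<in> multiples n (G\<lparr>carrier := K\<rparr>)"
      unfolding multiples_subgroup using subgroup_nat_pow_closed [OF K k(1)] by blast
  qed
  then show thesis using that n by blast
qed

lemma pure_subgroupI:
  assumes B: "subgroup B G"
    and pure: "\<And>n. B \<inter> pw n \<subseteq> multiples (p ^ n) (G\<lparr>carrier := B\<rparr>)"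
  shows "pure_subgroup B G"
proof -
  have Bc: "B \<subseteq> carrier G" by (rule subgroup.subset [OF B])
  have "B \<inter> multiples n G \<subseteq> multiples n (G\<lparr>carrier := B\<rparr>)" for n
  proof (cases "n = 0")
    case True
    then show ?thesis
      using subgroup.one_closed [OF B] unfolding multiples_subgroup by (auto simp: multiples_def)
  next
    case False
    then obtain v c where "n = p ^ v * c"
      and vc: "\<And>K. subgroup K G \<Longrightarrow> multiples n (G\<lparr>carrier := K\<rparr>) = multiples (p ^ v) (G\<lparr>carrier := K\<rparr>)"
      using multiples_prime_power_decompose [of n] by blast
    then show ?thesis using pure [of v] vc [OF B] vc [OF subgroup_self] by simp
  qed
  moreover have "multiples n (G\<lparr>carrier := B\<rparr>) \<subseteq> B \<inter> multiples n G" for n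
    using multiples_subgroup_subset [OF Bc] subgroup_nat_pow_closed [OF B]
    unfolding multiples_subgroup by blast
  ultimately show ?thesis using B unfolding pure_subgroup_def by blast
qed

text \<open>Every coset of \<open>B\<close> has a representative in \<open>pw v\<close>, where
  \<open>p ^ v\<close> is the p-part of the given \<open>n\<close>; this representative is also an
  n-th multiple.\<close>

lemma divisible_quotientI:
  assumes B: "subgroup B G" and dense: "\<And>n. carrier G \<subseteq> pw n <#> B"
  shows "divisible_group (G Mod B)"
proof -
  have nB: "B \<lhd> G" using B by (simp add: subgroup_imp_normal)
  interpret Q: group "G Mod B" by (rule normal.factorgroup_is_group [OF nB])
  have hom: "(\<lambda>a. B #> a) \<in> hom G (G Mod B)" by (rule normal.r_coset_hom_Mod [OF nB])
  have "multiples n (G Mod B) = carrier (G Mod B)" if n: "n > 0" for n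
  proof (intro subset_antisym subsetI)
    fix q assume "q \<in> multiples n (G Mod B)"
    then show "q \<in> carrier (G Mod B)" unfolding multiples_def by auto
  next
    fix q assume "q \<in> carrier (G Mod B)"
    then obtain g where g: "g \<in> carrier G" "q = B #> g" unfolding FactGroup_def RCOSETS_def by auto
    obtain v c where "n = p ^ v * c"
      and vc: "\<And>K. subgroup K G \<Longrightarrow> multiples n (G\<lparr>carrier := K\<rparr>) = multiples (p ^ v) (G\<lparr>carrier := K\<rparr>)"
      using multiples_prime_power_decompose [OF n] by blast
    obtain x b where x: "x \<in> pw v" "b \<in> B" "g = x \<otimes> b"
      using dense [of v] g(1) unfolding set_mult_def by blast
    then have "x \<in> multiples n G" using vc [OF subgroup_self] by simp
    then obtain w where w: "w \<in> carrier G" "x = w [^] n" unfolding multiples_def by blast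
    have bc: "b \<in> carrier G" by (rule subgroup.mem_carrier [OF B x(2)])
    have "g = b \<otimes> w [^] n" using x w bc by (simp add: m_comm)
    then have "g \<in> B #> (w [^] n)" using x(2) unfolding r_coset_def by blast
    then have "q = B #> (w [^] n)" using g(2) repr_independence [OF _ nat_pow_closed [OF w(1)] B] by simp
    also have "\<dots> = (B #> w) [^]\<^bsub>G Mod B\<^esub> n"
      using hom_nat_pow [OF hom w(1) is_group Q.is_group] .
    finally have "q = (B #> w) [^]\<^bsub>G Mod B\<^esub> n" .
    moreover have "B #> w \<in> carrier (G Mod B)" using hom w(1) by (auto simp: hom_def)
    ultimately show "q \<in> multiples n (G Mod B)" unfolding multiples_def by blast
  qed
  then show ?thesis unfolding divisible_group_def by blast
qed

text \<open>Density lifts from the socle to \<open>G\<close> by induction on the order. If p^k x + u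
  = p^(k+n) w with u in the span of \<open>A\<close>, then u has height at least \<open>k\<close>,
  so u = p^k b with b in \<open>B\<close> by purity. The element x + b - p^n w is killed by
  \<open>p ^ k\<close>.\<close>

lemma dense_height_independent_basic:
  assumes A: "height_independent A"
    and dense: "\<And>v n. v \<in> socle \<Longrightarrow> \<exists>u\<in>generate G A. v \<otimes> u \<in> pw n"
  obtains B where "basic_subgroup B G" "subgroup B G" "B \<inter> socle = generate G A"
    "\<forall>n. carrier G \<subseteq> pw n <#> B"
proof -
  obtain B where B: "subgroup B G" "B \<inter> socle = generate G A"
    "\<And>n. B \<inter> pw n \<subseteq> multiples (p ^ n) (G\<lparr>carrier := B\<rparr>)"
    "direct_sum_of_cyclics (G\<lparr>carrier := B\<rparr>)"
    using height_independent_basis [OF A] by blast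
  have T: "subgroup (pw n <#> B) G" for n by (rule mult_subgroups [OF subgroup_multiples B(1)])
  have BT: "b \<in> pw n <#> B" if "b \<in> B" for b n
  proof -
    have "b = \<one> \<otimes> b" using subgroup.mem_carrier [OF B(1) that] by simp
    then show ?thesis
      using that subgroup.one_closed [OF subgroup_multiples] unfolding set_mult_def by blast
  qed
  have PT: "x \<in> pw n <#> B" if "x \<in> pw n" for x n
  proof -
    have "x = x \<otimes> \<one>" using subgroup.mem_carrier [OF subgroup_multiples that] by simp
    then show ?thesis using that subgroup.one_closed [OF B(1)] unfolding set_mult_def by blast
  qed
  have "x \<in> pw n <#> B" if "x \<in> carrier G" "x [^] (p ^ k) = \<one>" for x k n
    using that
  proof (induction k arbitrary: x)
    case 0
    then show ?case using subgroup.one_closed [OF T] by simp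
  next
    case (Suc k)
    note xc = Suc.prems(1)
    have "x [^] (p ^ k) \<in> socle" using Suc.prems by (simp add: socle_def nat_pow_pow mult.commute)
    then obtain u where u: "u \<in> generate G A" "x [^] (p ^ k) \<otimes> u \<in> pw (k + n)" using dense by blast
    have uB: "u \<in> B" using u(1) B(2) by blast
    have uc: "u \<in> carrier G" by (rule subgroup.mem_carrier [OF B(1) uB])
    have "x [^] (p ^ k) \<otimes> u \<in> pw k" using u(2) pw_mono [of k "k + n"] by auto
    then have "u \<in> pw k" by (rule subgroup_mult_cancel_left [OF subgroup_multiples uc pwI [OF xc]])
    then obtain b where b: "b \<in> B" "u = b [^] (p ^ k)" using B(3) [of k] uB unfolding multiples_subgroup by blast
    have bc: "b \<in> carrier G" by (rule subgroup.mem_carrier [OF B(1) b(1)])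
    obtain w where w: "w \<in> carrier G" "x [^] (p ^ k) \<otimes> u = w [^] (p ^ (k + n))" using pwE [OF u(2)] by blast
    define t where "t = x \<otimes> b \<otimes> inv (w [^] (p ^ n))"
    have tc: "t \<in> carrier G" unfolding t_def using xc bc w(1) by simp
    have "t [^] (p ^ k) = (x [^] (p ^ k) \<otimes> b [^] (p ^ k)) \<otimes> inv (w [^] (p ^ (k + n)))"
      unfolding t_def using xc bc w(1)
      by (simp add: nat_pow_distrib nat_pow_inv nat_pow_pow power_add mult.commute)
    also have "\<dots> = \<one>" using w b(2) by simp
    finally have tT: "t \<in> pw n <#> B" using Suc.IH tc by blast
    have "x \<otimes> b \<in> pw n <#> B"
      using tT unfolding t_def
      by (rule subgroup_mult_cancel_right [OF T m_closed [OF xc bc]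
            subgroup.m_inv_closed [OF T PT [OF pwI [OF w(1)]]]])
    then show ?case by (rule subgroup_mult_cancel_right [OF T xc BT [OF b(1)]])
  qed
  then have d: "carrier G \<subseteq> pw n <#> B" for n using torsion by (meson subsetI)
  have "basic_subgroup B G"
    unfolding basic_subgroup_def
    using pure_subgroupI [OF B(1,3)] B(4) divisible_quotientI [OF B(1) d] by blast
  then show thesis using that B(1,2) d by blast
qed

section \<open>Pierce's condition for large subgroups\<close>

text \<open>Combinations of differences have coefficient sum zero, whereas c x has sum
  \<open>c\<close>. The induction removes one difference x - y at a time: comparing the coefficients
  of \<open>y\<close> shows that \<open>p\<close> divides its coefficient \<open>k\<close>, so its
  term vanishes.\<close>

lemma differences_not_generate:
  assumes A: "height_independent A" and x: "x \<in> A" and F: "finite F" "F \<subseteq> A - {x}"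
    and c: "x [^] (c::nat) \<in> generate G ((\<lambda>y. x \<otimes> inv y) ` F)"
  shows "p dvd c"
  using F c
proof (induction F arbitrary: c)
  case empty
  then have "x [^] c \<in> generate G (A - {x})" using generate.one by (auto simp: generate_empty)
  then show ?case by (rule height_independent_not_generated [OF A x])
next
  case (insert y F)
  have Ac: "A \<subseteq> carrier G" by (rule height_independent_carrier [OF A])
  have yc: "y \<in> A" "y \<noteq> x" "y \<in> carrier G" "x \<in> carrier G" using insert.prems x Ac by auto
  define E where "E = (\<lambda>y. x \<otimes> inv y) ` F"
  have Ec: "E \<subseteq> carrier G" unfolding E_def using insert.prems Ac x by auto
  have xy: "x \<otimes> inv y \<in> carrier G" using yc by simp
  have "x [^] c \<in> generate G (insert (x \<otimes> inv y) E)" using insert.prems unfolding E_def by simp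
  then obtain k :: nat and u where u: "u \<in> generate G E" "x [^] c = (x \<otimes> inv y) [^] k \<otimes> u"
    by (rule generate_insertE [OF xy Ec])
  have uc: "u \<in> carrier G" by (rule generate_in_carrier [OF Ec u(1)])
  have K: "subgroup (generate G (A - {y})) G" using Ac by (intro generate_is_subgroup) blast
  have xK: "x \<in> generate G (A - {y})" using x yc(2) by (intro generate.incl) simp
  have "x \<otimes> inv z \<in> generate G (A - {y})" if "z \<in> F" for z
  proof -
    have "z \<in> A - {y}" using that insert by auto
    then have "inv z \<in> generate G (A - {y})" by (rule generate.inv)
    then show ?thesis using xK by (simp add: generate.eng)
  qed
  then have "E \<subseteq> generate G (A - {y})" unfolding E_def by blast
  then have uK: "u \<in> generate G (A - {y})" using u(1) generate_subgroup_incl [OF _ K] by blast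
  have "y [^] k \<otimes> (x \<otimes> inv y) [^] k = (y \<otimes> (x \<otimes> inv y)) [^] k"
    by (rule nat_pow_distrib [OF yc(3) xy, symmetric])
  also have "y \<otimes> (x \<otimes> inv y) = x" using yc by (simp add: m_lcomm)
  finally have xk: "y [^] k \<otimes> (x \<otimes> inv y) [^] k = x [^] k" .
  have "y [^] k \<otimes> x [^] c = (y [^] k \<otimes> (x \<otimes> inv y) [^] k) \<otimes> u"
    unfolding u(2) by (rule m_assoc [symmetric, OF nat_pow_closed [OF yc(3)] nat_pow_closed [OF xy] uc])
  then have "y [^] k \<otimes> x [^] c = x [^] k \<otimes> u" unfolding xk .
  moreover have "x [^] k \<otimes> u \<in> generate G (A - {y})"
    by (rule generate.eng [OF subgroup_nat_pow_closed [OF K xK] uK])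
  ultimately have "y [^] k \<otimes> x [^] c \<in> generate G (A - {y})" by simp
  then have "y [^] k \<in> generate G (A - {y})"
    by (rule subgroup_mult_cancel_right [OF K nat_pow_closed [OF yc(3)] subgroup_nat_pow_closed [OF K xK]])
  then have k: "p dvd k" by (rule height_independent_not_generated [OF A yc(1)])
  have "x \<in> socle" "y \<in> socle" using A x yc(1) unfolding height_independent_def by auto
  then have "x \<otimes> inv y \<in> socle" 
    by (intro subgroup.m_closed [OF subgroup_socle] subgroup.m_inv_closed [OF subgroup_socle])
  then have "x [^] c = u" using u(2) k uc by (simp add: socle_pow_dvd)
  then show ?case using insert.IH u(1) insert.prems(1) unfolding E_def by simp
qed

text \<open>Two consequences of G = L + B are combined. Modulo \<open>omega\<close>, multiplication
  by \<open>p ^ k\<close> kills \<open>L\<close>, so the span of every dense height-independent set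
  fills the socle up to \<open>omega\<close>. A set \<open>A\<close> with elements of arbitrarily
  large height then leads to a contradiction; otherwise a basic subgroup \<open>B\<close> is bounded
  and drops out after multiplication by \<open>p ^ n\<close>.\<close>

lemma large_subgroup_omega_case:
  assumes L: "large_subgroup L G" and k: "\<And>l. l \<in> L \<Longrightarrow> l [^] (p ^ k) \<in> omega"
  obtains N where "pw N \<subseteq> L"
proof -
  have subL: "subgroup L G" using L unfolding large_subgroup_def fully_invariant_def by blast
  have basic: "carrier G = L <#> B" if "basic_subgroup B G" for B
    using L that unfolding large_subgroup_def by blast
  have key: "socle \<subseteq> omega <#> generate G A"
    if A: "height_independent A"
      and dense: "\<And>v n. v \<in> socle \<Longrightarrow> \<exists>u\<in>generate G A. v \<otimes> u \<in> pw n" for A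
  proof
    obtain B where B: "basic_subgroup B G" "subgroup B G" "B \<inter> socle = generate G A"
      "\<forall>n. carrier G \<subseteq> pw n <#> B"
      by (rule dense_height_independent_basic [OF A dense])
    have triv: "omega \<inter> B = {\<one>}"
    proof (rule trivial_socle [OF subgroups_Inter_pair [OF subgroup_omega B(2)]])
      show "omega \<inter> B \<inter> socle \<subseteq> {\<one>}" using B(3) height_independent_generate_omega [OF A] by blast
    qed
    fix v assume v: "v \<in> socle"
    then obtain x b where x: "x \<in> pw k" "b \<in> B" "v = x \<otimes> b"
      using B(4) socle_carrier unfolding set_mult_def by blast
    obtain g where g: "g \<in> carrier G" "x = g [^] (p ^ k)" using pwE [OF x(1)] by blast
    obtain l b' where l: "l \<in> L" "b' \<in> B" "g = l \<otimes> b'"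
      using basic [OF B(1)] g(1) unfolding set_mult_def by blast
    have c: "l \<in> carrier G" "b' \<in> carrier G" "b \<in> carrier G"
      using l x subgroup.mem_carrier [OF subL] subgroup.mem_carrier [OF B(2)] by auto
    define w where "w = l [^] (p ^ k)"
    define b0 where "b0 = b' [^] (p ^ k) \<otimes> b"
    have w: "w \<in> omega" "w \<in> carrier G" unfolding w_def using k l(1) c by auto
    have b0: "b0 \<in> B" "b0 \<in> carrier G"
      unfolding b0_def using x(2) l(2) subgroup_nat_pow_closed [OF B(2)] subgroup.m_closed [OF B(2)] c by auto
    have veq: "v = w \<otimes> b0"
      unfolding w_def b0_def using x(3) g(2) l(3) c by (simp add: nat_pow_distrib m_assoc)
    \<comment> \<open>As \<open>omega\<close> and \<open>B\<close> are disjoint, p v = 0 forces p w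
      and p b0 to vanish separately; so \<open>b0\<close> lies in the socle of \<open>B\<close>, the
      span of \<open>A\<close>.\<close>
    have "w [^] p \<otimes> b0 [^] p = \<one>" using v w b0 unfolding veq by (simp add: socle_def nat_pow_distrib)
    then have "w [^] p = inv (b0 [^] p)" using w b0 by (metis inv_equality nat_pow_closed)
    moreover have "inv (b0 [^] p) \<in> B"
      using b0(1) subgroup_nat_pow_closed [OF B(2)] subgroup.m_inv_closed [OF B(2)] by blast
    moreover have "w [^] p \<in> omega" by (rule subgroup_nat_pow_closed [OF subgroup_omega w(1)])
    ultimately have "w [^] p = \<one>" "inv (b0 [^] p) = \<one>" using triv by auto
    then have "b0 [^] p = \<one>" using b0(2) by (simp add: inv_eq_1_iff)
    then have "b0 \<in> generate G A" using b0 B(3) unfolding socle_def by blast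
    then show "v \<in> omega <#> generate G A" using w(1) veq unfolding set_mult_def by blast
  qed
  obtain A where "{} \<subseteq> A" and A: "A \<subseteq> socle" "height_independent A"
    and dense0: "\<forall>v\<in>socle. \<forall>n. \<exists>u\<in>generate G A. v \<otimes> u \<in> pw n"
    by (rule height_independent_maximal_dense
        [OF subgroup_socle order_refl height_independent_empty empty_subsetI])
  have dense: "\<exists>u\<in>generate G A. v \<otimes> u \<in> pw n" if "v \<in> socle" for v n using dense0 that by blast
  have Ac: "A \<subseteq> carrier G" by (rule height_independent_carrier [OF A(2)])
  have genA: "subgroup (generate G A) G" by (rule generate_is_subgroup [OF Ac])
  have "\<exists>N. pw N \<subseteq> L"
  proof (cases "\<exists>n. A \<inter> pw n = {}")
    case True
    then obtain n where n: "A \<inter> pw n = {}" by blast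
    obtain B where B: "basic_subgroup B G" "subgroup B G" "B \<inter> socle = generate G A"
      "\<forall>n. carrier G \<subseteq> pw n <#> B"
      by (rule dense_height_independent_basic [OF A(2) dense])
    have triv: "B \<inter> pw n = {\<one>}"
    proof (rule trivial_socle [OF subgroups_Inter_pair [OF B(2) subgroup_multiples]])
      show "B \<inter> pw n \<inter> socle \<subseteq> {\<one>}"
        using B(3) height_independent_generate_pw [OF A(2), of _ n] n by (auto simp: generate_empty)
    qed
    have "x \<in> L" if x: "x \<in> pw n" for x
    proof -
      obtain g where g: "g \<in> carrier G" "x = g [^] (p ^ n)" using pwE [OF x] by blast
      obtain l b where l: "l \<in> L" "b \<in> B" "g = l \<otimes> b"
        using basic [OF B(1)] g(1) unfolding set_mult_def by blast
      have c: "l \<in> carrier G" "b \<in> carrier G"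
        using l subgroup.mem_carrier [OF subL] subgroup.mem_carrier [OF B(2)] by auto
      have "b [^] (p ^ n) = \<one>"
        using triv subgroup_nat_pow_closed [OF B(2) l(2)] pwI [OF c(2)] by blast
      then have "x = l [^] (p ^ n)" using g l c by (simp add: nat_pow_distrib)
      then show ?thesis using subgroup_nat_pow_closed [OF subL l(1)] by simp
    qed
    then show ?thesis by blast
  next
    case False
    then obtain x where x: "x \<in> A" by blast
    have xc: "x \<in> carrier G" using x Ac by blast
    define D where "D = (\<lambda>y. x \<otimes> inv y) ` (A - {x})"
    have Dc: "D \<subseteq> carrier G" unfolding D_def using Ac xc by auto
    define S where "S = generate G D"
    have S: "subgroup S G" unfolding S_def by (rule generate_is_subgroup [OF Dc])
    have "D \<subseteq> generate G A"
    proof -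
      have "x \<otimes> inv y \<in> generate G A" if "y \<in> A - {x}" for y
        using that x by (intro generate.eng generate.incl generate.inv) auto
      then show ?thesis unfolding D_def by blast
    qed
    then have SA: "S \<subseteq> generate G A" unfolding S_def by (rule generate_subgroup_incl [OF _ genA])
    then have Ssoc: "S \<subseteq> socle" using height_independent_generate_socle [OF A(2)] by blast
    have diff: "x \<otimes> inv y \<in> S" if "y \<in> A" for y
    proof (cases "y = x")
      case True
      then show ?thesis using xc subgroup.one_closed [OF S] by simp
    next
      case False
      then show ?thesis unfolding S_def D_def using that by (intro generate.incl) blast
    qed
    \<comment> \<open>\<open>A\<close> has an element \<open>y\<close> in every \<open>pw n\<close>,
      and each \<open>a\<close> in \<open>A\<close> is congruent to the difference a - y modulo
      \<open>pw n\<close>. So \<open>S\<close> approximates the whole span of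
      \<open>A\<close>.\<close>
    have Sdense: "\<exists>s\<in>S. v \<otimes> s \<in> pw n" if v: "v \<in> socle" for v n
    proof -
      have vc: "v \<in> carrier G" by (rule socle_carrier [OF v])
      obtain u where u: "u \<in> generate G A" "v \<otimes> u \<in> pw n" using dense [OF v] by blast
      obtain y where y: "y \<in> A" "y \<in> pw n" using False by blast
      have yc: "y \<in> carrier G" using y Ac by blast
      have T: "subgroup (S <#> pw n) G" by (rule mult_subgroups [OF S subgroup_multiples])
      have "a \<in> S <#> pw n" if a: "a \<in> A" for a
      proof -
        have ac: "a \<in> carrier G" using a Ac by blast
        have "a = (inv (x \<otimes> inv a) \<otimes> (x \<otimes> inv y)) \<otimes> y"
        proof -
          have "inv (x \<otimes> inv a) = a \<otimes> inv x" using xc ac by (simp add: inv_mult_group)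
          then show ?thesis using xc ac yc by (simp add: m_assoc inv_solve_left')
        qed
        moreover have "inv (x \<otimes> inv a) \<otimes> (x \<otimes> inv y) \<in> S"
          by (rule subgroup.m_closed [OF S subgroup.m_inv_closed [OF S diff [OF a]] diff [OF y(1)]])
        ultimately show ?thesis using y(2) unfolding set_mult_def by blast
      qed
      then have "generate G A \<subseteq> S <#> pw n" by (intro generate_subgroup_incl [OF _ T]) blast
      then obtain s t where s: "s \<in> S" "t \<in> pw n" "u = s \<otimes> t" using u(1) unfolding set_mult_def by blast
      have c: "s \<in> carrier G" "t \<in> carrier G"
        using s subgroup.mem_carrier [OF S] subgroup.mem_carrier [OF subgroup_multiples] by auto
      have "v \<otimes> s \<otimes> t \<in> pw n" using u(2) s(3) vc c by (simp add: m_assoc)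
      then have "v \<otimes> s \<in> pw n"
        by (rule subgroup_mult_cancel_right [OF subgroup_multiples m_closed [OF vc c(1)] s(2)])
      then show ?thesis using s(1) by blast
    qed
    obtain A1 where "{} \<subseteq> A1" and A1: "A1 \<subseteq> S" "height_independent A1"
      and dense1: "\<forall>v\<in>S. \<forall>n. \<exists>u\<in>generate G A1. v \<otimes> u \<in> pw n"
      by (rule height_independent_maximal_dense [OF S Ssoc height_independent_empty empty_subsetI])
    have genA1: "subgroup (generate G A1) G"
      by (rule generate_is_subgroup [OF height_independent_carrier [OF A1(2)]])
    have "\<exists>u\<in>generate G A1. v \<otimes> u \<in> pw n" if v: "v \<in> socle" for v n
    proof -
      obtain s where s: "s \<in> S" "v \<otimes> s \<in> pw n" using Sdense [OF v] by blast
      obtain u where u: "u \<in> generate G A1" "s \<otimes> u \<in> pw n" using dense1 s(1) by blast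
      have c: "v \<in> carrier G" "s \<in> carrier G" "u \<in> carrier G"
        using socle_carrier [OF v] subgroup.mem_carrier [OF S s(1)] subgroup.mem_carrier [OF genA1 u(1)] by auto
      have "v \<otimes> inv u = (v \<otimes> s) \<otimes> inv (s \<otimes> u)" using c by (simp add: inv_mult m_assoc) (simp flip: m_assoc)
      also have "\<dots> \<in> pw n"
        by (rule subgroup.m_closed [OF subgroup_multiples s(2) subgroup.m_inv_closed [OF subgroup_multiples u(2)]])
      finally show ?thesis using subgroup.m_inv_closed [OF genA1 u(1)] by blast
    qed
    \<comment> \<open>\<open>A1\<close> lies in \<open>S\<close> and is dense in the socle, so
      \<open>x\<close> lies in \<open>omega <#> S\<close>. Its \<open>omega\<close> component lies
      in the span of \<open>A\<close> and is trivial, which leaves \<open>x\<close> as a combination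
      of differences.\<close>
    then have "socle \<subseteq> omega <#> generate G A1" by (rule key [OF A1(2)])
    then obtain w s where w: "w \<in> omega" "s \<in> generate G A1" "x = w \<otimes> s"
      using x A(1) unfolding set_mult_def by blast
    have sS: "s \<in> S" using w(2) generate_subgroup_incl [OF A1(1) S] by blast
    have c: "w \<in> carrier G" "s \<in> carrier G"
      using subgroup.mem_carrier [OF subgroup_omega w(1)] subgroup.mem_carrier [OF S sS] by auto
    have "w \<otimes> s \<in> generate G A" using w(3) x by (simp add: generate.incl)
    then have "w \<in> generate G A" using sS SA by (intro subgroup_mult_cancel_right [OF genA c(1)]) auto
    then have "w = \<one>" using height_independent_generate_omega [OF A(2)] w(1) by blast
    then have "x \<in> S" using w(3) c sS by simp
    then obtain E where E: "finite E" "E \<subseteq> D" "x \<in> generate G E"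
      unfolding S_def by (rule generate_finite_support)
    then obtain F where F: "finite F" "F \<subseteq> A - {x}" "E = (\<lambda>y. x \<otimes> inv y) ` F"
      unfolding D_def using finite_subset_image by metis
    have "x [^] (1::nat) \<in> generate G ((\<lambda>y. x \<otimes> inv y) ` F)" using E(3) F(3) xc by simp
    then have "p dvd 1" by (rule differences_not_generate [OF A(2) x F(1,2)])
    then show ?thesis using prime_p by (metis not_prime_unit)
  qed
  then show thesis using that by blast
qed

lemma large_subgroup_pierce:
  assumes L: "large_subgroup L G"
  obtains N where "\<And>x. x \<in> pw N \<Longrightarrow> x [^] (p ^ k) = \<one> \<Longrightarrow> x \<in> L"
proof -
  have "fully_invariant L G" using L unfolding large_subgroup_def by blast
  then consider "\<exists>N. \<forall>x\<in>pw N. x [^] (p ^ k) = \<one> \<longrightarrow> x \<in> L" | "\<forall>l\<in>L. l [^] (p ^ k) \<in> omega"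
    using fully_invariant_dichotomy [of L k] by blast
  then show thesis
  proof cases
    case 1
    then show ?thesis using that by blast
  next
    case 2
    then obtain N where "pw N \<subseteq> L" using large_subgroup_omega_case [OF L, of k] by blast
    then show ?thesis using that by blast
  qed
qed

section \<open>Heights in \<open>L\<close> compared with heights in \<open>G\<close>, and the
  transfer\<close>

text \<open>Write x = p^n y with y in \<open>pw N\<close>. Then y is killed by p^(n+k), so Pierce's
  condition for the exponent n + k puts y into \<open>L\<close>.\<close>

lemma large_subgroup_pw_socle:
  assumes L: "large_subgroup L G"
  obtains m where "\<And>x. x \<in> pw m \<Longrightarrow> x [^] (p ^ k) = \<one> \<Longrightarrow> x \<in> multiples (p ^ n) (G\<lparr>carrier := L\<rparr>)"
proof -
  obtain N where N: "\<And>x. x \<in> pw N \<Longrightarrow> x [^] (p ^ (n + k)) = \<one> \<Longrightarrow> x \<in> L"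
    using large_subgroup_pierce [OF L, of "n + k"] by blast
  have "x \<in> multiples (p ^ n) (G\<lparr>carrier := L\<rparr>)" if x: "x \<in> pw (N + n)" "x [^] (p ^ k) = \<one>" for x
  proof -
    obtain z where z: "z \<in> carrier G" "x = z [^] (p ^ (N + n))" using pwE [OF x(1)] by blast
    define y where "y = z [^] (p ^ N)"
    have y: "y \<in> pw N" "y \<in> carrier G" "x = y [^] (p ^ n)"
      unfolding y_def using z by (auto simp: nat_pow_pow power_add intro: pwI)
    have "y [^] (p ^ (n + k)) = \<one>" using x(2) y(2,3) by (simp add: nat_pow_pow power_add)
    then show ?thesis using N [OF y(1)] y(3) unfolding multiples_subgroup by blast
  qed
  then show thesis using that by blast
qed

lemma large_subgroup_omega:
  assumes L: "large_subgroup L G"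
  shows "p_omega p (G\<lparr>carrier := L\<rparr>) = omega"
proof (intro subset_antisym subsetI)
  have sub: "subgroup L G" using L unfolding large_subgroup_def fully_invariant_def by blast
  show "x \<in> omega" if "x \<in> p_omega p (G\<lparr>carrier := L\<rparr>)" for x
    using that multiples_subgroup_subset [OF subgroup.subset [OF sub]] unfolding p_omega_def by blast
  fix x assume x: "x \<in> omega"
  have "x \<in> carrier G" by (rule subgroup.mem_carrier [OF subgroup_omega x])
  then obtain k where k: "x [^] (p ^ k) = \<one>" using torsion by blast
  have "x \<in> multiples (p ^ n) (G\<lparr>carrier := L\<rparr>)" for n
    using large_subgroup_pw_socle [OF L, of k n] x k by (metis omega_iff)
  then show "x \<in> p_omega p (G\<lparr>carrier := L\<rparr>)" unfolding p_omega_def by blast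
qed

text \<open>Both directions use \<open>sigma_group_iff\<close>. Going down to \<open>L\<close>, the
  filtration is intersected with \<open>L\<close>. Going up, a filtration of the socle of
  \<open>L\<close> covers only part of the socle of \<open>G\<close>, and a fixed complement of a
  high enough part is added to each term.\<close>

lemma sigma_group_large_subgroup_iff:
  assumes L: "large_subgroup L G"
  shows "sigma_group p G \<longleftrightarrow> sigma_group p (G\<lparr>carrier := L\<rparr>)"
proof -
  have sub: "subgroup L G" using L unfolding large_subgroup_def fully_invariant_def by blast
  interpret L: primary_group "G\<lparr>carrier := L\<rparr>" p by (rule primary_subgroup [OF sub])
  note omega_L = large_subgroup_omega [OF L]
  note socle_L = subgroup_socle_restrict [OF sub]
  have L_pw: "L.pw n \<subseteq> pw n" for n by (rule multiples_subgroup_subset [OF subgroup.subset [OF sub]])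
  show ?thesis
  proof
    assume "sigma_group p G"
    then obtain P where P: "(\<forall>n. subgroup (P n) G) \<and> (\<forall>n::nat. P n \<subseteq> P (Suc n)) \<and> (\<Union>n. P n) = socle \<and>
        (\<forall>n. \<exists>m. P n \<inter> pw m \<subseteq> omega)" unfolding sigma_group_iff by (rule exE)
    have PG: "subgroup (P n) G" and Pmono: "P n \<subseteq> P (Suc n)" and Pun: "(\<Union>n. P n) = socle"
      and Pbound: "\<exists>m. P n \<inter> pw m \<subseteq> omega" for n using P by simp_all
    show "sigma_group p (G\<lparr>carrier := L\<rparr>)"
      unfolding L.sigma_group_iff
    proof (intro exI [of _ "\<lambda>n. P n \<inter> L"] conjI allI)
      show "subgroup (P n \<inter> L) (G\<lparr>carrier := L\<rparr>)" for n
        by (rule subgroup_incl [OF subgroups_Inter_pair [OF PG sub] sub]) simp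
      show "P n \<inter> L \<subseteq> P (Suc n) \<inter> L" for n using Pmono by blast
      show "(\<Union>n. P n \<inter> L) = L.socle" unfolding socle_L using Pun by blast
      show "\<exists>m. P n \<inter> L \<inter> L.pw m \<subseteq> L.omega" for n
      proof -
        obtain m where "P n \<inter> pw m \<subseteq> omega" using Pbound [of n] by (rule exE)
        then show ?thesis unfolding omega_L using L_pw [of m] by (intro exI [of _ m]) blast
      qed
    qed
  next
    assume "sigma_group p (G\<lparr>carrier := L\<rparr>)"
    then obtain Q where Q: "(\<forall>n. subgroup (Q n) (G\<lparr>carrier := L\<rparr>)) \<and> (\<forall>n::nat. Q n \<subseteq> Q (Suc n)) \<and>
        (\<Union>n. Q n) = L.socle \<and> (\<forall>n. \<exists>m. Q n \<inter> L.pw m \<subseteq> L.omega)"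
      unfolding L.sigma_group_iff by (rule exE)
    have Qbound: "\<exists>m. Q n \<inter> L.pw m \<subseteq> omega" for n using Q unfolding omega_L by simp
    have QG: "subgroup (Q n) G" for n by (rule incl_subgroup [OF sub]) (simp add: Q)
    have Qun: "(\<Union>n. Q n) = socle \<inter> L" using Q unfolding socle_L by simp
    then have Qsoc: "Q n \<subseteq> socle \<inter> L" for n by blast
    \<comment> \<open>Pierce's condition with exponent 1: the socle elements in \<open>pw N\<close>
      already belong to \<open>L\<close>.\<close>
    obtain N where N: "\<And>x. x \<in> pw N \<Longrightarrow> x [^] (p ^ 1) = \<one> \<Longrightarrow> x \<in> L"
      using large_subgroup_pierce [OF L] by blast
    have NL: "x \<in> L.socle" if "x \<in> pw N" "x \<in> socle" for x
      using N [OF that(1)] that unfolding socle_L by (simp add: socle_def)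
    have C: "subgroup (pw N \<inter> socle) G" by (rule subgroups_Inter_pair [OF subgroup_multiples subgroup_socle])
    have "{\<one>} \<inter> (pw N \<inter> socle) = {\<one>}" using subgroup.one_closed [OF C] by blast
    \<comment> \<open>\<open>M \<inter> socle\<close> will serve as a complement of
      \<open>pw N \<inter> socle\<close> in the socle.\<close>
    then obtain M where M: "subgroup M G" "{\<one>} \<subseteq> M" "M \<inter> (pw N \<inter> socle) = {\<one>}"
      and max: "\<forall>K. subgroup K G \<longrightarrow> K \<inter> (pw N \<inter> socle) = {\<one>} \<longrightarrow> M \<subseteq> K \<longrightarrow> K = M"
      by (rule maximal_disjoint_subgroup [OF triv_subgroup])
    have socM: "socle \<subseteq> M <#> (pw N \<inter> socle)"
      by (rule maximal_disjoint_socle [OF M(1) C M(3)]) (use max in blast)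
    define P where "P n = (M \<inter> socle) <#> (Q n \<inter> pw N)" for n
    have Psub: "subgroup (P n) G" for n
      unfolding P_def
      by (intro mult_subgroups subgroups_Inter_pair M(1) subgroup_socle QG subgroup_multiples)
    have Pmono: "P n \<subseteq> P (Suc n)" for n
    proof -
      have "Q n \<subseteq> Q (Suc n)" using Q by simp
      then show ?thesis unfolding P_def set_mult_def by blast
    qed
    have "P n \<subseteq> socle" for n
      unfolding P_def set_mult_def using Qsoc [of n] subgroup.m_closed [OF subgroup_socle] by blast
    moreover have "\<exists>n. x \<in> P n" if x: "x \<in> socle" for x
    proof -
      obtain a c where ac: "a \<in> M" "c \<in> pw N" "c \<in> socle" "x = a \<otimes> c"
        using socM x unfolding set_mult_def by blast
      have "a \<in> socle"
        using subgroup_mult_cancel_right [OF subgroup_socle subgroup.mem_carrier [OF M(1) ac(1)] ac(3)]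
          x ac(4) by simp
      moreover obtain n where "c \<in> Q n" using NL [OF ac(2,3)] Qun unfolding socle_L by blast
      ultimately show ?thesis using ac unfolding P_def set_mult_def by blast
    qed
    ultimately have Pun: "(\<Union>n. P n) = socle" by blast
    have Pbound: "\<exists>j. P n \<inter> pw j \<subseteq> omega" for n
    proof -
      obtain i where i: "Q n \<inter> L.pw i \<subseteq> omega" using Qbound [of n] by (rule exE)
      obtain m where m: "\<And>x. x \<in> pw m \<Longrightarrow> x [^] (p ^ 1) = \<one> \<Longrightarrow> x \<in> L.pw i"
        using large_subgroup_pw_socle [OF L, of 1 i] by blast
      \<comment> \<open>Height at least \<open>N\<close> eliminates the component in
        \<open>M\<close>, since \<open>M\<close> avoids \<open>pw N \<inter> socle\<close>. Height
        at least \<open>m\<close> puts what remains into \<open>L.pw i\<close>, where the bound for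
        \<open>Q n\<close> applies.\<close>
      have "z \<in> omega" if z: "z \<in> P n" "z \<in> pw (max N m)" for z
      proof -
        obtain a q where aq: "a \<in> M" "a \<in> socle" "q \<in> Q n" "q \<in> pw N" "z = a \<otimes> q"
          using z(1) unfolding P_def set_mult_def by blast
        have zpw: "z \<in> pw N" "z \<in> pw m" using z(2) pw_mono [of N "max N m"] pw_mono [of m "max N m"] by auto
        have "a \<in> pw N"
          using subgroup_mult_cancel_right [OF subgroup_multiples socle_carrier [OF aq(2)] aq(4)]
            zpw(1) aq(5) by simp
        then have "a = \<one>" using M(3) aq(1,2) by blast
        then have "z = q" using aq(5) subgroup.mem_carrier [OF QG aq(3)] by simp
        moreover have "q \<in> socle" using Qsoc aq(3) by blast
        ultimately show ?thesis using m [OF zpw(2)] i aq(3) by (auto simp: socle_def)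
      qed
      then show ?thesis by (intro exI [of _ "max N m"]) blast
    qed
    show "sigma_group p G"
      unfolding sigma_group_iff
    proof (intro exI [of _ P] conjI allI)
      show "subgroup (P n) G" for n by (rule Psub)
      show "P n \<subseteq> P (Suc n)" for n by (rule Pmono)
      show "(\<Union>n. P n) = socle" by (rule Pun)
      show "\<exists>j. P n \<inter> pw j \<subseteq> omega" for n by (rule Pbound)
    qed
  qed
qed

end

theorem theorem4:
  fixes G :: "('a, 'b) monoid_scheme" and p :: nat and L :: "'a set"
  assumes "Factorial_Ring.prime p"
    and "abelian_p_group p G"
    and "large_subgroup L G"
  shows "sigma_group p G \<longleftrightarrow> sigma_group p (G\<lparr>carrier := L\<rparr>)"
proof -
  interpret primary_group G p
    using assms(1,2) unfolding abelian_p_group_def primary_group_def primary_group_axioms_def by blast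
  show ?thesis by (rule sigma_group_large_subgroup_iff [OF assms(3)])
qed

end
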